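(* Let $T$ be an arbitrary index set. A real-valued stochastic process $X=\{X_t;\,t\in T\}$ is QID if there exist two ID processes $Y=\{Y_t;\,t\in T\}$ and $Z=\{Z_t;\,t\in T\}$ such that $X+Y\stackrel{d}{=}Z$ with $Y$ independent of $X$.
   Context: For processes, $\stackrel{d}{=}$ denotes equality of all finite-dimensional distributions. A process is ID if all its finite-dimensional distributions are infinitely divisible. A process $X$ is QID if for every finite set of indices $t_1,\dots,t_k\in T$ the random vector $(X_{t_1},\dots,X_{t_k})$ is a multivariate QID random variable. Let $\tau(x)=x$ if $\|x\|\le1$ and $\tau(x)=x/\|x\|$ if $\|x\|>1$. A quasi-Lévy type measure on $\mathbb{R}^d$ is a real-valued function $\nu$ on the Borel sets $B\subset\mathbb{R}^d$ with $0\notin\overline B$, whose restriction to $\{B\text{ Borel}:B\cap\{\|x\|<r\}=\emptyset\}$ is a finite signed measure for every $r>0$, and with $\int(1\wedge\|x\|^2)|\nu|(dx)<\infty$, where $|\nu|,\nu^+,\nu^-$ are the unique measures on $\mathcal{B}(\mathbb{R}^d)$ with no mass at $0$ extending the total variations, positive parts and negative parts of the restrictions; $\int g\,d\nu:=\int g\,d\nu^+-\int g\,d\nu^-$. A distribution $\mu$ on $\mathbb{R}^d$ is quasi-infinitely divisible (QID) if for some $\gamma\in\mathbb{R}^d$, symmetric $A\in\mathbb{R}^{d\times d}$ and quasi-Lévy type measure $\nu$, $$\hat\mu(\theta)=\exp\Big(i\langle\theta,\gamma\rangle-\tfrac12\langle\theta,A\theta\rangle+\int_{\mathbb{R}^d}(e^{i\langle\theta,x\rangle}-1-i\langle\theta,\tau(x)\rangle)\nu(dx)\Big),\quad\theta\in\mathbb{R}^d.$$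 *)

theory Defs
  imports "HOL-Probability.Probability"
begin

text \<open>
  The space \<open>\<real>\<^sup>d\<close> is rendered as \<open>\<real>\<^sup>I\<close> for a finite set \<open>I\<close> of coordinates: the extensional
  functions \<open>I \<rightarrow> \<real>\<close> with the product Borel \<open>\<sigma>\<close>-algebra. Every definition below is meant for
  finite \<open>I\<close>, except that the product \<open>\<sigma>\<close>-algebra is also used for whole processes.
\<close>

abbreviation R_space :: "'i set \<Rightarrow> ('i \<Rightarrow> real) measure" where
  "R_space I \<equiv> PiM I (\<lambda>_. borel)"

definition R_zero :: "'i set \<Rightarrow> 'i \<Rightarrow> real" where
  "R_zero I = (\<lambda>i\<in>I. 0)"

definition R_inner :: "'i set \<Rightarrow> ('i \<Rightarrow> real) \<Rightarrow> ('i \<Rightarrow> real) \<Rightarrow> real" where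
  "R_inner I x y = (\<Sum>i\<in>I. x i * y i)"

abbreviation R_norm :: "'i set \<Rightarrow> ('i \<Rightarrow> real) \<Rightarrow> real" where
  "R_norm I x \<equiv> L2_set x I"

definition distribution_on :: "'i set \<Rightarrow> ('i \<Rightarrow> real) measure \<Rightarrow> bool" where
  "distribution_on I \<mu> \<longleftrightarrow> prob_space \<mu> \<and> sets \<mu> = sets (R_space I)"

definition char_fn :: "'i set \<Rightarrow> ('i \<Rightarrow> real) measure \<Rightarrow> ('i \<Rightarrow> real) \<Rightarrow> complex" where
  "char_fn I \<mu> \<theta> = (CLINT x|\<mu>. iexp (R_inner I \<theta> x))"


subsection \<open>Infinitely divisible distributions\<close>

text \<open>For each \<open>n \<ge> 1\<close>, \<open>\<mu>\<close> is the law of the sum of \<open>n\<close> i.i.d. random vectors of law \<open>\<rho>\<close>.\<close>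

definition inf_divisible :: "'i set \<Rightarrow> ('i \<Rightarrow> real) measure \<Rightarrow> bool" where
  "inf_divisible I \<mu> \<longleftrightarrow> distribution_on I \<mu> \<and>
     (\<forall>n::nat\<ge>1. \<exists>\<rho>. distribution_on I \<rho> \<and>
        \<mu> = distr (PiM {..<n} (\<lambda>_. \<rho>)) (R_space I) (\<lambda>x. \<lambda>i\<in>I. \<Sum>k<n. x k i))"


subsection \<open>Finite signed measures\<close>

text \<open>\<open>\<A>\<close> is a \<open>\<sigma>\<close>-algebra on some subset of the ambient type.\<close>

definition finite_signed_measure :: "'a set set \<Rightarrow> ('a set \<Rightarrow> real) \<Rightarrow> bool" where
  "finite_signed_measure \<A> \<nu> \<longleftrightarrow> \<nu> {} = 0 \<and>
     (\<forall>B :: nat \<Rightarrow> 'a set. range B \<subseteq> \<A> \<longrightarrow> disjoint_family B \<longrightarrow>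
        (\<lambda>n. \<nu> (B n)) sums \<nu> (\<Union>n. B n))"

text \<open>
  In \<open>pos_part\<close> and \<open>neg_part\<close> the coercion truncates negative values to \<open>0\<close>, which does not
  affect the suprema because \<open>E = {}\<close> contributes \<open>0\<close>.
\<close>

definition pos_part :: "('a set \<Rightarrow> real) \<Rightarrow> 'a set set \<Rightarrow> 'a set \<Rightarrow> ennreal" where
  "pos_part \<nu> \<A> B = (SUP E\<in>{E \<in> \<A>. E \<subseteq> B}. ennreal (\<nu> E))"

definition neg_part :: "('a set \<Rightarrow> real) \<Rightarrow> 'a set set \<Rightarrow> 'a set \<Rightarrow> ennreal" where
  "neg_part \<nu> \<A> B = (SUP E\<in>{E \<in> \<A>. E \<subseteq> B}. ennreal (- \<nu> E))"

definition total_variation :: "('a set \<Rightarrow> real) \<Rightarrow> 'a set set \<Rightarrow> 'a set \<Rightarrow> ennreal" where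
  "total_variation \<nu> \<A> B =
     (SUP P\<in>{P. finite P \<and> P \<subseteq> \<A> \<and> partition_on B P}. ennreal (\<Sum>E\<in>P. \<bar>\<nu> E\<bar>))"


subsection \<open>Quasi-Levy type measures\<close>

text \<open>
  The Borel sets avoiding the open ball of radius \<open>r\<close>. The union of these over \<open>r > 0\<close> consists
  of the Borel sets whose closure does not contain \<open>0\<close>, the domain of a quasi-Levy type
  measure. Such a measure is represented by a total function, whose values outside the domain
  are never used.
\<close>

definition sets_off :: "'i set \<Rightarrow> real \<Rightarrow> ('i \<Rightarrow> real) set set" where
  "sets_off I r = {B \<in> sets (R_space I). B \<inter> {x. R_norm I x < r} = {}}"

text \<open>
  \<open>extends_off I F m\<close>: the measure \<open>m\<close> has no mass at \<open>0\<close> and extends the set functions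
  \<open>F (sets_off I r)\<close>, \<open>r > 0\<close>.
\<close>

definition extends_off ::
  "'i set \<Rightarrow> (('i \<Rightarrow> real) set set \<Rightarrow> ('i \<Rightarrow> real) set \<Rightarrow> ennreal) \<Rightarrow> ('i \<Rightarrow> real) measure \<Rightarrow> bool" where
  "extends_off I F m \<longleftrightarrow> sets m = sets (R_space I) \<and> emeasure m {R_zero I} = 0 \<and>
     (\<forall>r>0. \<forall>B\<in>sets_off I r. emeasure m B = F (sets_off I r) B)"

lemma extends_off_unique:
  assumes I: "finite I" and m: "extends_off I F m" and m': "extends_off I F m'"
  shows "m = m'"
proof (rule measure_eqI)
  show sets_eq: "sets m = sets m'"
    using m m' by (simp add: extends_off_def)
  fix A assume "A \<in> sets m"
  then have A: "A \<in> sets (R_space I)"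
    using m by (simp add: extends_off_def)
  define U where "U n = A \<inter> {x \<in> space (R_space I). inverse (Suc n) \<le> R_norm I x}" for n
  have norm_meas [measurable]: "(\<lambda>x. R_norm I x) \<in> borel_measurable (R_space I)"
    unfolding L2_set_def by measurable
  have U: "U n \<in> sets (R_space I)" for n
    unfolding U_def using A by measurable
  have U_off: "U n \<in> sets_off I (inverse (Suc n))" for n
    using U[of n] by (auto simp: sets_off_def U_def)
  have inc: "incseq U"
  proof (rule incseq_SucI)
    fix n
    have "inverse (real (Suc (Suc n))) \<le> inverse (real (Suc n))"
      by (simp add: field_simps)
    from order_trans[OF this] show "U n \<le> U (Suc n)"
      unfolding U_def by blast
  qed
  have zero_iff: "x = R_zero I" if "x \<in> space (R_space I)" "R_norm I x = 0" for x
  proof -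
    have "x i = 0" if "i \<in> I" for i
      using \<open>R_norm I x = 0\<close> that by (simp add: L2_set_eq_0_iff[OF I])
    then show ?thesis
      using that(1) unfolding R_zero_def space_PiM
      by (intro extensionalityI[of x I]) (auto simp: PiE_iff)
  qed
  have UN: "A - {R_zero I} \<subseteq> (\<Union>n. U n)"
  proof
    fix x assume x: "x \<in> A - {R_zero I}"
    then have sp: "x \<in> space (R_space I)"
      using sets.sets_into_space[OF A] by auto
    have "R_norm I x > 0"
      using zero_iff[OF sp] x L2_set_nonneg[of x I]
      by (metis DiffE insertI1 order_le_less)
    then obtain n where "inverse (Suc n) < R_norm I x"
      using reals_Archimedean by blast
    then show "x \<in> (\<Union>n. U n)"
      using x sp by (auto simp: U_def intro!: exI[of _ n])
  qed
  have *: "emeasure k A = emeasure k (\<Union>n. U n)"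
    if k: "extends_off I F k" for k
  proof (rule antisym)
    have sets_k: "sets k = sets (R_space I)" and k0: "emeasure k {R_zero I} = 0"
      using k by (auto simp: extends_off_def)
    have z: "{R_zero I} \<in> sets k"
    proof -
      have "{R_zero I} = {x \<in> space (R_space I). R_norm I x = 0}"
        using zero_iff by (auto simp: R_zero_def space_PiM L2_set_eq_0_iff[OF I])
      then show ?thesis
        unfolding sets_k by simp
    qed
    have UN_k: "(\<Union>n. U n) \<in> sets k"
      using U sets_k by auto
    have "emeasure k A \<le> emeasure k ((\<Union>n. U n) \<union> {R_zero I})"
      using UN by (intro emeasure_mono sets.Un[OF UN_k z]) auto
    also have "\<dots> \<le> emeasure k (\<Union>n. U n) + emeasure k {R_zero I}"
      using UN_k z by (intro emeasure_subadditive) auto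
    finally show "emeasure k A \<le> emeasure k (\<Union>n. U n)"
      using k0 by simp
    show "emeasure k (\<Union>n. U n) \<le> emeasure k A"
      using A sets_k by (intro emeasure_mono) (auto simp: U_def)
  qed
  have "emeasure m (\<Union>n. U n) = (SUP n. emeasure m (U n))"
    using U inc m by (intro SUP_emeasure_incseq[symmetric]) (auto simp: extends_off_def)
  also have "\<dots> = (SUP n. emeasure m' (U n))"
  proof -
    have "emeasure m (U n) = emeasure m' (U n)" for n
    proof -
      have "(0::real) < inverse (Suc n)" by simp
      then show ?thesis
        using m m' U_off[of n] unfolding extends_off_def by metis
    qed
    then show ?thesis by simp
  qed
  also have "\<dots> = emeasure m' (\<Union>n. U n)"
    using U inc m' by (intro SUP_emeasure_incseq) (auto simp: extends_off_def)
  finally show "emeasure m A = emeasure m' A"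
    using *[OF m] *[OF m'] by simp
qed

definition q_pos :: "'i set \<Rightarrow> (('i \<Rightarrow> real) set \<Rightarrow> real) \<Rightarrow> ('i \<Rightarrow> real) measure" where
  "q_pos I \<nu> = (THE m. extends_off I (pos_part \<nu>) m)"

definition q_neg :: "'i set \<Rightarrow> (('i \<Rightarrow> real) set \<Rightarrow> real) \<Rightarrow> ('i \<Rightarrow> real) measure" where
  "q_neg I \<nu> = (THE m. extends_off I (neg_part \<nu>) m)"

definition q_var :: "'i set \<Rightarrow> (('i \<Rightarrow> real) set \<Rightarrow> real) \<Rightarrow> ('i \<Rightarrow> real) measure" where
  "q_var I \<nu> = (THE m. extends_off I (total_variation \<nu>) m)"

definition quasi_levy_type :: "'i set \<Rightarrow> (('i \<Rightarrow> real) set \<Rightarrow> real) \<Rightarrow> bool" where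
  "quasi_levy_type I \<nu> \<longleftrightarrow>
     (\<forall>r>0. finite_signed_measure (sets_off I r) \<nu>) \<and>
     (\<integral>\<^sup>+ x. ennreal (min 1 ((R_norm I x)\<^sup>2)) \<partial>q_var I \<nu>) < \<infinity>"

definition q_integral ::
  "'i set \<Rightarrow> (('i \<Rightarrow> real) set \<Rightarrow> real) \<Rightarrow> (('i \<Rightarrow> real) \<Rightarrow> complex) \<Rightarrow> complex" where
  "q_integral I \<nu> g = (CLINT x|q_pos I \<nu>. g x) - (CLINT x|q_neg I \<nu>. g x)"


subsection \<open>Quasi-infinitely divisible distributions\<close>

definition trunc :: "'i set \<Rightarrow> ('i \<Rightarrow> real) \<Rightarrow> 'i \<Rightarrow> real" where
  "trunc I x = (if R_norm I x \<le> 1 then x else (\<lambda>i\<in>I. x i / R_norm I x))"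

definition quasi_inf_divisible :: "'i set \<Rightarrow> ('i \<Rightarrow> real) measure \<Rightarrow> bool" where
  "quasi_inf_divisible I \<mu> \<longleftrightarrow> distribution_on I \<mu> \<and>
     (\<exists>(\<gamma> :: 'i \<Rightarrow> real) (A :: 'i \<Rightarrow> 'i \<Rightarrow> real) \<nu>.
        \<gamma> \<in> space (R_space I) \<and>
        (\<forall>i\<in>I. \<forall>j\<in>I. A i j = A j i) \<and>
        quasi_levy_type I \<nu> \<and>
        (\<forall>\<theta>\<in>space (R_space I).
           char_fn I \<mu> \<theta> =
             exp (\<i> * of_real (R_inner I \<theta> \<gamma>)
                  - of_real (R_inner I \<theta> (\<lambda>i\<in>I. \<Sum>j\<in>I. A i j * \<theta> j)) / 2
                  + q_integral I \<nu> (\<lambda>x. iexp (R_inner I \<theta> x) - 1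
                                          - \<i> * of_real (R_inner I \<theta> (trunc I x))))))"


subsection \<open>Processes\<close>

definition process :: "'a measure \<Rightarrow> 't set \<Rightarrow> ('t \<Rightarrow> 'a \<Rightarrow> real) \<Rightarrow> bool" where
  "process M T X \<longleftrightarrow> prob_space M \<and> (\<forall>t\<in>T. X t \<in> borel_measurable M)"

definition fdd :: "'a measure \<Rightarrow> ('t \<Rightarrow> 'a \<Rightarrow> real) \<Rightarrow> 't set \<Rightarrow> ('t \<Rightarrow> real) measure" where
  "fdd M X J = distr M (R_space J) (\<lambda>\<omega>. \<lambda>t\<in>J. X t \<omega>)"

text \<open>The two processes may live on different probability spaces.\<close>

definition fdd_equal ::
  "'t set \<Rightarrow> 'a measure \<Rightarrow> ('t \<Rightarrow> 'a \<Rightarrow> real) \<Rightarrow> 'b measure \<Rightarrow> ('t \<Rightarrow> 'b \<Rightarrow> real) \<Rightarrow> bool" where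
  "fdd_equal T M X N Y \<longleftrightarrow> (\<forall>J. finite J \<and> J \<subseteq> T \<longrightarrow> fdd M X J = fdd N Y J)"

definition ID_process :: "'a measure \<Rightarrow> 't set \<Rightarrow> ('t \<Rightarrow> 'a \<Rightarrow> real) \<Rightarrow> bool" where
  "ID_process M T X \<longleftrightarrow> process M T X \<and>
     (\<forall>J. finite J \<and> J \<subseteq> T \<longrightarrow> inf_divisible J (fdd M X J))"

definition QID_process :: "'a measure \<Rightarrow> 't set \<Rightarrow> ('t \<Rightarrow> 'a \<Rightarrow> real) \<Rightarrow> bool" where
  "QID_process M T X \<longleftrightarrow> process M T X \<and>
     (\<forall>J. finite J \<and> J \<subseteq> T \<longrightarrow> quasi_inf_divisible J (fdd M X J))"

text \<open>
  Independence of the \<open>\<sigma>\<close>-algebras generated by the two whole processes; the product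
  \<open>\<sigma>\<close>-algebra on \<open>\<real>\<^sup>T\<close> is the cylindrical one.
\<close>

definition indep_processes ::
  "'a measure \<Rightarrow> 't set \<Rightarrow> ('t \<Rightarrow> 'a \<Rightarrow> real) \<Rightarrow> ('t \<Rightarrow> 'a \<Rightarrow> real) \<Rightarrow> bool" where
  "indep_processes M T X Y \<longleftrightarrow>
     prob_space.indep_var M (R_space T) (\<lambda>\<omega>. \<lambda>t\<in>T. X t \<omega>) (R_space T) (\<lambda>\<omega>. \<lambda>t\<in>T. Y t \<omega>)"

end

theory Submission
  imports Defs
begin

text \<open>
  Only one finite set \<open>J\<close> of indices matters at a time. Independence turns \<open>X + Y = Z\<close> into
  a product of characteristic functions on \<open>\<real>\<^sup>J\<close>. Both the laws of \<open>Y\<close> and \<open>Z\<close> have a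
  Levy-Khintchine representation, so the characteristic function of \<open>Y\<close> has no zeros and that of
  \<open>X\<close> is the exponential of a difference of two Levy-Khintchine exponents
  (\<open>quasi_inf_divisible_of_quotient\<close>). Subtracting drifts and covariance matrices is harmless,
  since the matrix of a quasi-infinitely divisible law is only required to be symmetric, and the
  difference of two Levy measures is a quasi-Levy type measure: with densities with respect to
  a common finite measure its positive part, negative part and total variation are explicit
  (\<open>quasi_levy_type_difference\<close>). A Levy measure is represented throughout by the finite
  measure \<open>G\<close> of which it is the multiple by \<open>1 / w\<close>, where \<open>w x = min 1 \<parallel>x\<parallel>\<^sup>2\<close>; since \<open>0 / 0 = 0\<close>,
  the mass of \<open>G\<close> at the origin does not enter.

  The main work is the Levy-Khintchine formula on \<open>\<real>\<^sup>I\<close>, \<open>I\<close> finite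
  (\<open>inf_divisible_levy_khintchine\<close>). Let \<open>\<mu>\<close> be the \<open>n\<close>-fold convolution of \<open>\<rho>\<^sub>n\<close> for every \<open>n\<close>, with
  characteristic functions \<open>\<phi>\<close> and \<open>\<phi>\<^sub>n\<close>. Along every line through the origin \<open>\<phi>\<close> has a
  continuous logarithm \<open>g\<close> with \<open>\<phi>\<^sub>n = exp (g / n)\<close>, so \<open>n (\<phi>\<^sub>n - 1)\<close> converges to a logarithm
  \<open>\<Psi>\<close> of \<open>\<phi>\<close>. With \<open>t\<close> the inner product of \<open>\<theta>\<close> with the truncation of \<open>x\<close>, write
  \<open>exp (i \<langle>\<theta>, x\<rangle>) - 1 = i t - t\<^sup>2 / 2 + w k\<close>. The remainder \<open>k\<close> is bounded and continuous, also at
  the origin, where subtracting the quadratic term removes the dependence on the direction. The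
  measures with density \<open>n w\<close> with respect to \<open>\<rho>\<^sub>n\<close> have bounded mass and are tight, because the
  size of \<open>n (1 - \<phi>\<^sub>n)\<close> near the origin controls truncated second moments. Hence the integrals
  of \<open>k\<close> converge along a subsequence, and then the drifts and the second moments, being the
  imaginary and real parts of what is left, converge too. The limit of the second moments is the
  Gaussian covariance plus the truncated second moment of the Levy measure, so the latter is
  subtracted at the end.

  Compactness of tight sequences on \<open>\<real>\<^sup>I\<close> is reduced to Helly's theorem on the line by a Borel
  injection of \<open>\<real>\<^sup>I\<close> into \<open>\<real>\<close> that has a continuous left inverse
  (\<open>tight_R_space_imp_convergent_subsequence\<close>).
\<close>

section \<open>Compactness of tight sequences of distributions\<close>

text \<open>
  Base \<open>3\<close> instead of \<open>2\<close> leaves gaps between codes, as in the Cantor set: the code determines the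
  bits, and does so continuously.
\<close>

definition bit_code :: "(nat \<Rightarrow> 'a \<Rightarrow> bool) \<Rightarrow> 'a \<Rightarrow> real" where
  "bit_code a x = (\<Sum>k. of_bool (a k x) * (1 / 3) ^ Suc k)"

lemma summable_bit_code: "summable (\<lambda>k. of_bool (a k x) * (1 / 3 :: real) ^ Suc k)"
  by (rule summable_comparison_test'[where g = "\<lambda>k. (1 / 3 :: real) ^ Suc k" and N = 0])
     (auto intro!: summable_geometric)

lemma bit_code_bounds: "0 \<le> bit_code a x" "bit_code a x \<le> 1 / 2"
proof -
  show "0 \<le> bit_code a x"
    unfolding bit_code_def by (rule suminf_nonneg[OF summable_bit_code]) auto
  have s: "(\<lambda>k. (1 / 3 :: real) ^ Suc k) sums (1 / 2)"
    using sums_mult[OF geometric_sums[of "1 / 3 :: real"], of "1 / 3"] by simp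
  have "bit_code a x \<le> (\<Sum>k. (1 / 3 :: real) ^ Suc k)"
    unfolding bit_code_def
    by (rule suminf_le[OF _ summable_bit_code sums_summable[OF s]]) auto
  then show "bit_code a x \<le> 1 / 2"
    using sums_unique[OF s] by simp
qed

lemma bit_code_split:
  "bit_code a x = (\<Sum>k<n. of_bool (a k x) * (1 / 3) ^ Suc k)
     + (1 / 3) ^ n * bit_code (\<lambda>k. a (k + n)) x"
proof -
  have "(\<Sum>k. of_bool (a (k + n) x) * (1 / 3 :: real) ^ Suc (k + n))
      = (1 / 3) ^ n * bit_code (\<lambda>k. a (k + n)) x"
    unfolding bit_code_def
    by (subst suminf_mult[OF summable_bit_code, symmetric]) (simp add: power_add mult_ac)
  then show ?thesis
    unfolding bit_code_def
    using suminf_split_initial_segment[OF summable_bit_code, of a x n] by simp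
qed

text \<open>
  The tail after the first differing bit contributes at most half of the weight of that bit.
\<close>

lemma bit_code_close_imp_eq:
  assumes "\<bar>bit_code a x - bit_code a y\<bar> < (1 / 3) ^ n / 2" and "k < n"
  shows "a k x = a k y"
  using assms(2)
proof (induction k rule: less_induct)
  case (less k)
  show ?case
  proof (rule ccontr)
    assume neq: "a k x \<noteq> a k y"
    have pre: "(\<Sum>j<k. of_bool (a j x) * (1 / 3 :: real) ^ Suc j)
        = (\<Sum>j<k. of_bool (a j y) * (1 / 3 :: real) ^ Suc j)"
      using less by (intro sum.cong) auto
    define r where "r z = bit_code (\<lambda>j. a (j + Suc k)) z" for z
    have r: "0 \<le> r z" "r z \<le> 1 / 2" for z
      unfolding r_def by (rule bit_code_bounds)+
    have "bit_code a x - bit_code a y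
        = (of_bool (a k x) - of_bool (a k y) + (r x - r y)) * (1 / 3) ^ Suc k"
      using bit_code_split[of a x "Suc k"] bit_code_split[of a y "Suc k"] pre
      by (simp add: r_def field_simps)
    moreover have "\<bar>of_bool (a k x) - of_bool (a k y) + (r x - r y)\<bar> \<ge> 1 / 2"
      using neq r[of x] r[of y] by (cases "a k x"; cases "a k y"; simp)
    ultimately have "\<bar>bit_code a x - bit_code a y\<bar> \<ge> (1 / 3) ^ Suc k / 2"
      by (simp add: abs_mult power_abs del: power_Suc)
    moreover have "(1 / 3 :: real) ^ n \<le> (1 / 3) ^ Suc k"
      using less.prems by (intro power_decreasing) auto
    ultimately show False
      using assms(1) by simp
  qed
qed

lemma measurable_bit_code [measurable]:
  assumes [measurable]: "\<And>k. Measurable.pred M (a k)"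
  shows "bit_code a \<in> borel_measurable M"
  unfolding bit_code_def by measurable

text \<open>
  The bits record the comparisons of the \<open>u i\<close> with all rationals. Finitely many of them locate a
  value in \<open>[-1, 1]\<close> up to a given error, and these finitely many are read off from \<open>c\<close> up to some \<open>\<delta>\<close>.
\<close>

lemma exists_uniform_code:
  fixes u :: "'i \<Rightarrow> 'x \<Rightarrow> real"
  assumes I: "countable I" and [measurable]: "\<And>i. i \<in> I \<Longrightarrow> u i \<in> borel_measurable M"
    and bd: "\<And>i x. i \<in> I \<Longrightarrow> x \<in> space M \<Longrightarrow> \<bar>u i x\<bar> \<le> 1"
  obtains c :: "'x \<Rightarrow> real" where "c \<in> borel_measurable M" "\<And>x. 0 \<le> c x" "\<And>x. c x \<le> 1 / 2"
    "\<And>i \<epsilon>. i \<in> I \<Longrightarrow> \<epsilon> > 0 \<Longrightarrow>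
       \<exists>\<delta>>0. \<forall>x\<in>space M. \<forall>y\<in>space M. \<bar>c x - c y\<bar> < \<delta> \<longrightarrow> \<bar>u i x - u i y\<bar> < \<epsilon>"
proof
  define e where "e = from_nat_into (I \<times> (UNIV :: rat set))"
  define a where "a k x = (fst (e k) \<in> I \<and> u (fst (e k)) x \<le> of_rat (snd (e k)))" for k x
  show "bit_code a \<in> borel_measurable M"
  proof (rule measurable_bit_code)
    fix k show "Measurable.pred M (a k)"
      unfolding a_def by (cases "fst (e k) \<in> I") simp_all
  qed
  show "0 \<le> bit_code a x" "bit_code a x \<le> 1 / 2" for x
    by (rule bit_code_bounds)+
  fix i and \<epsilon> :: real assume i: "i \<in> I" and "\<epsilon> > 0"
  then obtain N' :: nat where "1 / Suc N' < \<epsilon>"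
    by (auto elim!: nat_approx_posE)
  then obtain N :: nat where N: "N > 0" "1 / N < \<epsilon>"
    by blast
  define q :: "int \<Rightarrow> rat" where "q j = of_int j / of_nat N" for j
  have q: "real_of_rat (q j) = real_of_int j / real N" for j
    unfolding q_def by (simp add: of_rat_divide)
  have "\<exists>k. e k = (i, q j)" for j
    using from_nat_into_surj[of "I \<times> (UNIV :: rat set)" "(i, q j)"] I i
    by (auto simp: e_def)
  then obtain k where k: "\<And>j. e (k j) = (i, q j)"
    by metis
  define n where "n = Suc (Max (k ` {- int N..int N}))"
  have kn: "k j < n" if "j \<in> {- int N..int N}" for j
    unfolding n_def using that by (simp add: less_Suc_eq_le)
  show "\<exists>\<delta>>0. \<forall>x\<in>space M. \<forall>y\<in>space M.
      \<bar>bit_code a x - bit_code a y\<bar> < \<delta> \<longrightarrow> \<bar>u i x - u i y\<bar> < \<epsilon>"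
  proof (intro exI[of _ "(1 / 3) ^ n / 2"] conjI ballI impI)
    fix x y assume xy: "x \<in> space M" "y \<in> space M"
      "\<bar>bit_code a x - bit_code a y\<bar> < (1 / 3) ^ n / 2"
    have cmp: "u i x \<le> j / N \<longleftrightarrow> u i y \<le> j / N" if "j \<in> {- int N..int N}" for j
      using bit_code_close_imp_eq[OF xy(3) kn[OF that]] i by (simp add: a_def k q)
    (* The value of u i x lies in the cell ((j - 1) / N, j / N], and so does that of u i y. *)
    define j where "j = \<lceil>u i x * N\<rceil>"
    have bx: "- 1 \<le> u i x" "u i x \<le> 1" and by': "- 1 \<le> u i y" "u i y \<le> 1"
      using bd[OF i xy(1)] bd[OF i xy(2)] by linarith+
    have j: "u i x * N \<le> j" "real_of_int (j - 1) < u i x * N"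
      unfolding j_def by linarith+
    have "u i x * real N \<le> 1 * real N" "- 1 * real N \<le> u i x * real N"
      using bx by (intro mult_right_mono; simp)+
    then have jN: "- int N \<le> j" "j \<le> int N"
      unfolding j_def by (auto simp: ceiling_le_iff) linarith
    have up: "u i y \<le> j / N"
      using cmp[of j] jN j(1) N by (simp add: field_simps)
    have lo: "real_of_int (j - 1) / N < u i y"
    proof (cases "j = - int N")
      case True
      have "real_of_int (j - 1) / N < - 1"
        using N unfolding True by (simp add: field_simps)
      then show ?thesis using by'(1) by linarith
    next
      case False
      then show ?thesis
        using cmp[of "j - 1"] jN j(2) N by (auto simp: field_simps not_le)
    qed
    have "\<bar>u i x - u i y\<bar> \<le> 1 / N"
      using up lo j N bx by' by (auto simp: field_simps abs_le_iff)
    then show "\<bar>u i x - u i y\<bar> < \<epsilon>" using N by simp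
  qed simp
qed

text \<open>
  The hypothesis says that \<open>g\<close> is a uniformly continuous function of \<open>c\<close>; such a function extends
  to the closure of the range of \<open>c\<close>, and from there to the line by Tietze's theorem.
\<close>

lemma uniformly_determined_imp_continuous_factor:
  fixes c g :: "'x \<Rightarrow> real"
  assumes "\<And>\<epsilon>. \<epsilon> > 0 \<Longrightarrow> \<exists>\<delta>>0. \<forall>x\<in>A. \<forall>y\<in>A. \<bar>c x - c y\<bar> < \<delta> \<longrightarrow> \<bar>g x - g y\<bar> < \<epsilon>"
  obtains p :: "real \<Rightarrow> real" where "continuous_on UNIV p" "\<And>x. x \<in> A \<Longrightarrow> p (c x) = g x"
proof -
  define h where "h t = g (SOME x. x \<in> A \<and> c x = t)" for t
  have h: "h (c x) = g x" if "x \<in> A" for x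
  proof -
    define y where "y = (SOME y. y \<in> A \<and> c y = c x)"
    have y: "y \<in> A \<and> c y = c x"
      unfolding y_def by (rule someI[of _ x]) (use that in auto)
    have "\<bar>g y - g x\<bar> < \<epsilon>" if "\<epsilon> > 0" for \<epsilon>
      using assms[OF that] y \<open>x \<in> A\<close> by fastforce
    from this[of "\<bar>g y - g x\<bar>"] have "g y = g x"
      by auto
    then show ?thesis by (simp add: h_def y_def)
  qed
  have "uniformly_continuous_on (c ` A) h"
    unfolding uniformly_continuous_on_def
  proof (intro allI impI)
    fix \<epsilon> :: real assume "\<epsilon> > 0"
    from assms[OF this] obtain \<delta> where \<delta>: "\<delta> > 0"
      "\<And>x y. x \<in> A \<Longrightarrow> y \<in> A \<Longrightarrow> \<bar>c x - c y\<bar> < \<delta> \<Longrightarrow> \<bar>g x - g y\<bar> < \<epsilon>"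
      by blast
    show "\<exists>\<delta>>0. \<forall>s\<in>c ` A. \<forall>t\<in>c ` A. dist t s < \<delta> \<longrightarrow> dist (h t) (h s) < \<epsilon>"
      by (intro exI[of _ \<delta>]) (auto simp: \<delta> h dist_real_def)
  qed
  then obtain h' where h': "uniformly_continuous_on (closure (c ` A)) h'"
    "\<And>t. t \<in> c ` A \<Longrightarrow> h t = h' t"
    by (rule uniformly_continuous_on_extension_on_closure) blast
  obtain p where p: "continuous_on UNIV p" "\<And>t. t \<in> closure (c ` A) \<Longrightarrow> p t = h' t"
    by (rule Tietze_unbounded[of "closure (c ` A)" h' UNIV])
       (auto intro: uniformly_continuous_imp_continuous[OF h'(1)])
  show thesis
  proof (rule that[OF p(1)])
    fix x assume x: "x \<in> A"
    then have "c x \<in> closure (c ` A)"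
      by (intro subsetD[OF closure_subset] imageI)
    then show "p (c x) = g x"
      using p(2)[of "c x"] h'(2)[of "c x"] h[OF x] x by simp
  qed
qed

text \<open>
  The code \<open>c x\<close> is the integer part \<open>m x\<close> of the \<open>\<ell>\<^sup>1\<close>-norm plus a code in \<open>[0, 1/2]\<close> for the
  coordinates rescaled to \<open>[-1, 1]\<close>. The integer part makes codes of bounded sets bounded, so that the
  laws of \<open>c\<close> are tight, and the room between \<open>1/2\<close> and \<open>1\<close> makes \<open>m\<close> a uniformly continuous
  function of \<open>c\<close>. The resulting continuous left inverse \<open>p\<close> of \<open>c\<close> carries a weak limit on the line
  back to \<open>\<real>\<^sup>I\<close>. Continuity of \<open>f\<close> refers to the product topology on all functions.
\<close>

lemma tight_R_space_imp_convergent_subsequence: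
  fixes P :: "nat \<Rightarrow> ('i \<Rightarrow> real) measure"
  assumes I: "finite I" and P: "\<And>n. distribution_on I (P n)"
    and tight: "\<And>\<epsilon>. \<epsilon> > 0 \<Longrightarrow>
      \<exists>R. \<forall>n. measure (P n) {x \<in> space (R_space I). R < (\<Sum>i\<in>I. \<bar>x i\<bar>)} < \<epsilon>"
  obtains r L where "strict_mono r" "distribution_on I L"
    "\<And>(f :: ('i \<Rightarrow> real) \<Rightarrow> complex) B. continuous_on UNIV f \<Longrightarrow> f \<in> borel_measurable (R_space I)
       \<Longrightarrow> (\<And>x. norm (f x) \<le> B) \<Longrightarrow> (\<lambda>n. integral\<^sup>L (P (r n)) f) \<longlonglongrightarrow> integral\<^sup>L L f"
proof -
  interpret P: prob_space "P n" for n
    using P by (simp add: distribution_on_def)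
  have sets_P [measurable_cong]: "sets (P n) = sets (R_space I)" for n
    using P by (simp add: distribution_on_def)
  note space_P = sets_eq_imp_space_eq[OF sets_P]
  define m :: "('i \<Rightarrow> real) \<Rightarrow> real" where "m x = of_int \<lfloor>\<Sum>i\<in>I. \<bar>x i\<bar>\<rfloor>" for x
  have [measurable]: "m \<in> borel_measurable (R_space I)"
    unfolding m_def by measurable
  define u where "u i x = x i / (m x + 1)" for i x
  have m0: "0 \<le> m x" for x
    unfolding m_def by (simp add: sum_nonneg)
  have u: "u i \<in> borel_measurable (R_space I)" if "i \<in> I" for i
    unfolding u_def using that by measurable
  have u1: "\<bar>u i x\<bar> \<le> 1" if "i \<in> I" for i x
  proof -
    have "\<bar>x i\<bar> \<le> (\<Sum>i\<in>I. \<bar>x i\<bar>)"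
      using I that by (intro member_le_sum) auto
    also have "\<dots> \<le> m x + 1"
      unfolding m_def by linarith
    finally show ?thesis
      using m0[of x] unfolding u_def by (simp add: abs_divide)
  qed
  obtain c0 :: "('i \<Rightarrow> real) \<Rightarrow> real" where c0: "c0 \<in> borel_measurable (R_space I)"
    "\<And>x. 0 \<le> c0 x" "\<And>x. c0 x \<le> 1 / 2"
    "\<And>i \<epsilon>. i \<in> I \<Longrightarrow> \<epsilon> > 0 \<Longrightarrow> \<exists>\<delta>>0. \<forall>x\<in>space (R_space I). \<forall>y\<in>space (R_space I).
        \<bar>c0 x - c0 y\<bar> < \<delta> \<longrightarrow> \<bar>u i x - u i y\<bar> < \<epsilon>"
    by (rule exists_uniform_code[OF countable_finite[OF I], where u = u and M = "R_space I"])
       (use u u1 in auto)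
  note [measurable] = c0(1)
  define c where "c x = m x + c0 x" for x
  have c [measurable]: "c \<in> borel_measurable (R_space I)"
    unfolding c_def by measurable
  have m_eq: "m x = m y" if "\<bar>c x - c y\<bar> < 1 / 2" for x y
  proof -
    have "\<bar>m x - m y\<bar> < 1"
      using that c0(2,3)[of x] c0(2,3)[of y] unfolding c_def by linarith
    then show ?thesis unfolding m_def of_int_diff[symmetric] of_int_abs[symmetric] by simp
  qed
  let ?S = "space (R_space I)"
  obtain pm where pm: "continuous_on UNIV pm" "\<And>x. x \<in> ?S \<Longrightarrow> pm (c x) = m x"
  proof (rule uniformly_determined_imp_continuous_factor[of ?S c m])
    fix \<epsilon> :: real assume "\<epsilon> > 0"
    then show "\<exists>\<delta>>0. \<forall>x\<in>?S. \<forall>y\<in>?S. \<bar>c x - c y\<bar> < \<delta> \<longrightarrow> \<bar>m x - m y\<bar> < \<epsilon>"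
      by (intro exI[of _ "1 / 2"]) (auto simp: m_eq)
  qed blast
  have "\<exists>pu. continuous_on UNIV pu \<and> (\<forall>x\<in>?S. pu (c x) = u i x)" if i: "i \<in> I" for i
  proof (rule uniformly_determined_imp_continuous_factor[of ?S c "u i"])
    fix \<epsilon> :: real assume "\<epsilon> > 0"
    from c0(4)[OF i this] obtain \<delta> where \<delta>: "\<delta> > 0"
      "\<And>x y. x \<in> ?S \<Longrightarrow> y \<in> ?S \<Longrightarrow> \<bar>c0 x - c0 y\<bar> < \<delta> \<Longrightarrow> \<bar>u i x - u i y\<bar> < \<epsilon>"
      by blast
    show "\<exists>\<delta>>0. \<forall>x\<in>?S. \<forall>y\<in>?S. \<bar>c x - c y\<bar> < \<delta> \<longrightarrow> \<bar>u i x - u i y\<bar> < \<epsilon>"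
    proof (intro exI[of _ "min \<delta> (1 / 2)"] conjI ballI impI)
      fix x y assume xy: "x \<in> ?S" "y \<in> ?S" "\<bar>c x - c y\<bar> < min \<delta> (1 / 2)"
      then have "m x = m y" by (intro m_eq) simp
      then show "\<bar>u i x - u i y\<bar> < \<epsilon>"
        using xy by (intro \<delta>(2)) (auto simp: c_def)
    qed (use \<delta>(1) in auto)
  qed blast
  then obtain pu where pu: "\<And>i. i \<in> I \<Longrightarrow> continuous_on UNIV (pu i)"
    "\<And>i x. i \<in> I \<Longrightarrow> x \<in> ?S \<Longrightarrow> pu i (c x) = u i x"
    by metis
  define p where "p t = (\<lambda>i\<in>I. pu i t * (pm t + 1))" for t
  have pc: "p (c x) = x" if "x \<in> ?S" for x
  proof (rule extensionalityI[of _ I])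
    show "x \<in> extensional I" using that by (simp add: space_PiM PiE_def)
    fix i assume "i \<in> I"
    then show "p (c x) i = x i"
      using that m0[of x] by (simp add: p_def pm pu u_def)
  qed (simp add: p_def)
  have p_cont: "continuous_on UNIV p"
  proof (rule continuous_on_coordinatewise_then_product)
    fix i show "continuous_on UNIV (\<lambda>t. p t i)"
      unfolding p_def by (cases "i \<in> I") (auto intro!: continuous_intros pm pu)
  qed
  have p [measurable]: "p \<in> measurable borel (R_space I)"
    unfolding p_def using pu(1) pm(1)
    by (intro measurable_restrict borel_measurable_continuous_onI continuous_intros) auto
  define Q where "Q n = distr (P n) borel c" for n
  have c' [measurable]: "c \<in> borel_measurable (P n)" for n
    by measurable
  have Q: "real_distribution (Q n)" for n
    unfolding Q_def by (intro P.real_distribution_distr) (use c' in \<open>auto simp: measurable_def\<close>)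
  have "tight Q"
    unfolding tight_def
  proof (intro conjI allI impI Q)
    fix \<epsilon> :: real assume "\<epsilon> > 0"
    then obtain R where R: "\<And>n. measure (P n) {x \<in> ?S. R < (\<Sum>i\<in>I. \<bar>x i\<bar>)} < \<epsilon>"
      using tight by blast
    define b where "b = max R 0 + 1"
    have "1 - \<epsilon> < measure (Q n) {- 1<..b}" for n
    proof -
      have "1 - measure (P n) {x \<in> ?S. R < (\<Sum>i\<in>I. \<bar>x i\<bar>)}
          = measure (P n) (space (P n) - {x \<in> ?S. R < (\<Sum>i\<in>I. \<bar>x i\<bar>)})"
        by (subst P.prob_compl) (auto simp: space_P)
      also have "\<dots> \<le> measure (P n) (c -` {- 1<..b} \<inter> space (P n))"
      proof (rule P.finite_measure_mono)
        show "space (P n) - {x \<in> ?S. R < (\<Sum>i\<in>I. \<bar>x i\<bar>)} \<subseteq> c -` {- 1<..b} \<inter> space (P n)"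
        proof
          fix x assume x: "x \<in> space (P n) - {x \<in> ?S. R < (\<Sum>i\<in>I. \<bar>x i\<bar>)}"
          then have "(\<Sum>i\<in>I. \<bar>x i\<bar>) \<le> R" by (auto simp: space_P not_less)
          moreover have "m x \<le> (\<Sum>i\<in>I. \<bar>x i\<bar>)" unfolding m_def by linarith
          ultimately have "c x \<le> b" "- 1 < c x"
            using m0[of x] c0(2,3)[of x] unfolding c_def b_def by linarith+
          then show "x \<in> c -` {- 1<..b} \<inter> space (P n)" using x by simp
        qed
      qed measurable
      also have "\<dots> = measure (Q n) {- 1<..b}"
        unfolding Q_def by (subst measure_distr) auto
      finally show ?thesis using R[of n] by linarith
    qed
    then show "\<exists>a b. a < b \<and> (\<forall>n. 1 - \<epsilon> < measure (Q n) {a<..b})"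
      by (intro exI[of _ "- 1"] exI[of _ b]) (auto simp: b_def)
  qed
  from tight_imp_convergent_subsubsequence[OF this strict_mono_id]
  obtain r Q' where r: "strict_mono r" and Q': "real_distribution Q'" "weak_conv_m (Q \<circ> r) Q'"
    by auto
  interpret Q': real_distribution Q' by fact
  show thesis
  proof (rule that[of r "distr Q' (R_space I) p"])
    show "strict_mono r" by fact
    have p' [measurable]: "p \<in> measurable Q' (R_space I)"
      using p by (simp add: measurable_cong_sets[OF Q'.events_eq_borel refl])
    show "distribution_on I (distr Q' (R_space I) p)"
      unfolding distribution_on_def by (auto intro: Q'.prob_space_distr p')
    fix f :: "('i \<Rightarrow> real) \<Rightarrow> complex" and B
    assume f: "continuous_on UNIV f" and [measurable]: "f \<in> borel_measurable (R_space I)"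
      and B: "\<And>x. norm (f x) \<le> B"
    have "continuous_on UNIV (\<lambda>t. f (p t))"
      by (rule continuous_on_compose2[OF f p_cont]) auto
    then have "(\<lambda>n. integral\<^sup>L ((Q \<circ> r) n) (\<lambda>t. f (p t))) \<longlonglongrightarrow> integral\<^sup>L Q' (\<lambda>t. f (p t))"
      using Q B
      by (intro weak_conv_imp_integral_bdd_continuous_conv[OF _ Q'])
         (auto simp: continuous_on_eq_continuous_at)
    moreover have "integral\<^sup>L (Q n) (\<lambda>t. f (p t)) = integral\<^sup>L (P n) f" for n
    proof -
      have "integral\<^sup>L (Q n) (\<lambda>t. f (p t)) = integral\<^sup>L (P n) (\<lambda>x. f (p (c x)))"
        unfolding Q_def by (rule integral_distr) measurable
      also have "\<dots> = integral\<^sup>L (P n) f"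
        by (rule Bochner_Integration.integral_cong) (auto simp: space_P pc)
      finally show ?thesis .
    qed
    moreover have "integral\<^sup>L (distr Q' (R_space I) p) f = integral\<^sup>L Q' (\<lambda>t. f (p t))"
      by (rule integral_distr) measurable
    ultimately show "(\<lambda>n. integral\<^sup>L (P (r n)) f) \<longlonglongrightarrow> integral\<^sup>L (distr Q' (R_space I) p) f"
      by simp
  qed
qed

section \<open>Roots of characteristic functions on the real line\<close>

text \<open>
  For \<open>u \<le> 2\<close> from the Taylor polynomial of degree \<open>3\<close>, with error \<open>u ^ 5 / 120 \<le> u ^ 3 / 30\<close>; for larger
  \<open>u\<close> from \<open>sin u \<le> 1\<close>.
\<close>

lemma sin_le_linear_minus_min:
  fixes u :: real assumes "0 < u"
  shows "sin u \<le> u - u * min 1 (u\<^sup>2) / 9"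
proof (cases "u \<le> 2")
  case True
  have "(\<Sum>m<5. sin_coeff m * u ^ m) = u - u ^ 3 / 6"
    by (simp add: numeral_eq_Suc sin_coeff_Suc cos_coeff_Suc)
  then have "\<bar>sin u - (u - u ^ 3 / 6)\<bar> \<le> inverse (fact 5) * \<bar>u\<bar> ^ 5"
    using Maclaurin_sin_bound[of u 5] by simp
  then have "\<bar>sin u - (u - u ^ 3 / 6)\<bar> \<le> u ^ 5 / 120"
    using assms by (simp add: fact_numeral)
  then have "sin u \<le> u - u ^ 3 / 6 + u ^ 5 / 120"
    using abs_ge_self[of "sin u - (u - u ^ 3 / 6)"] by linarith
  also have "u ^ 5 \<le> u ^ 3 * 2\<^sup>2"
    using True assms mult_left_mono[OF power_mono[of u 2 2], of "u ^ 3"]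
    by (simp flip: power_add)
  finally have "sin u \<le> u - u ^ 3 * (2 / 15)"
    by simp
  then have "sin u \<le> u - u ^ 3 / 9"
    using zero_less_power[OF assms, of 3] by linarith
  moreover have "u * min 1 (u\<^sup>2) \<le> u ^ 3"
    using assms mult_left_mono[of "min 1 (u\<^sup>2)" "u\<^sup>2" u] by (simp add: power3_eq_cube power2_eq_square)
  ultimately show ?thesis by simp
next
  case False
  have "u * min 1 (u\<^sup>2) \<le> u"
    using assms by (simp add: mult_le_cancel_left1)
  then show ?thesis
    using False sin_le_one[of u] by linarith
qed

context real_distribution
begin

lemma Re_char: "Re (char M t) = expectation (\<lambda>x. cos (t * x))"
proof -
  have "complex_integrable M (\<lambda>x. iexp (t * x))"
    by (rule integrable_const_bound[of _ 1]) auto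
  then show ?thesis
    unfolding char_def by (subst integral_Re[symmetric]) (simp_all add: Re_exp)
qed

lemma integrable_cos: "integrable M (\<lambda>x. cos (t * x))"
  by (rule integrable_const_bound[of _ 1]) auto

lemma one_minus_Re_char: "1 - Re (char M t) = expectation (\<lambda>x. 1 - cos (t * x))"
  by (simp add: Re_char integrable_cos prob_space del: space_eq_univ)

text \<open>
  Integrate \<open>1 - cos (2 a) = 2 (1 - cos a) (1 + cos a) \<le> 4 (1 - cos a)\<close>.
\<close>

lemma one_minus_Re_char_double: "1 - Re (char M (2 * t)) \<le> 4 * (1 - Re (char M t))"
proof -
  have "expectation (\<lambda>x. 1 - cos (2 * t * x)) \<le> expectation (\<lambda>x. 4 * (1 - cos (t * x)))"
  proof (rule integral_mono)
    fix x :: real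
    have "1 - cos (2 * t * x) = 2 * (1 - cos (t * x)) * (1 + cos (t * x))"
      using cos_double_cos[of "t * x"] by (simp add: power2_eq_square algebra_simps)
    also have "\<dots> \<le> 2 * (1 - cos (t * x)) * 2"
      by (intro mult_left_mono) auto
    finally show "1 - cos (2 * t * x) \<le> 4 * (1 - cos (t * x))" by simp
  qed (intro Bochner_Integration.integrable_diff integrable_mult_right integrable_const integrable_cos)+
  then show ?thesis
    unfolding one_minus_Re_char Bochner_Integration.integral_mult_right_zero by simp
qed

lemma one_minus_Re_char_pow2: "1 - Re (char M (2 ^ k * t)) \<le> 4 ^ k * (1 - Re (char M t))"
proof (induction k)
  case (Suc k)
  have "1 - Re (char M (2 ^ Suc k * t)) \<le> 4 * (1 - Re (char M (2 ^ k * t)))"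
    using one_minus_Re_char_double[of "2 ^ k * t"] by (simp add: mult_ac)
  then show ?case using Suc by simp
qed simp

text \<open>
  Averaging \<open>1 - cos (s x)\<close> over \<open>s \<in> [0, h]\<close> gives \<open>1 - sin (h x) / (h x)\<close>, which is comparable to
  \<open>min 1 ((h x)\<^sup>2)\<close>; interchanging the integrals bounds the moment by the average of \<open>1 - Re (char M s)\<close>.
\<close>

lemma truncated_second_moment_le_char:
  assumes h: "0 < h" and \<eta>: "\<And>s. 0 \<le> s \<Longrightarrow> s \<le> h \<Longrightarrow> 1 - Re (char M s) \<le> \<eta>"
  shows "expectation (\<lambda>x. min 1 ((h * x)\<^sup>2)) \<le> 9 * \<eta>"
proof -
  interpret P: pair_sigma_finite M lborel ..
  have \<eta>0: "0 \<le> \<eta>" using \<eta>[of 0] h by (simp add: char_zero)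
  have int: "integrable M (\<lambda>x. min 1 ((h * x)\<^sup>2))"
    by (rule integrable_const_bound[of _ 1]) auto
  have low: "ennreal (h * min 1 ((h * x)\<^sup>2) / 9)
      \<le> (\<integral>\<^sup>+s. ennreal (1 - cos (s * x)) * indicator {0..h} s \<partial>lborel)" for x
  proof (cases "x = 0")
    case False
    have "(\<integral>\<^sup>+s. ennreal (1 - cos (s * x)) * indicator {0..h} s \<partial>lborel)
        = ennreal ((h - sin (h * x) / x) - (0 - sin (0 * x) / x))"
      using False h
      by (intro nn_integral_FTC_Icc)
         (auto intro!: derivative_eq_intros simp flip: has_real_derivative_iff_has_vector_derivative)
    moreover have "h * min 1 ((h * x)\<^sup>2) / 9 \<le> h - sin (h * x) / x"
    proof -
      have "sin (h * \<bar>x\<bar>) / \<bar>x\<bar> = sin (h * x) / x"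
        by (cases "x < 0") auto
      moreover have "sin (h * \<bar>x\<bar>) / \<bar>x\<bar>
          \<le> (h * \<bar>x\<bar> - h * \<bar>x\<bar> * min 1 ((h * \<bar>x\<bar>)\<^sup>2) / 9) / \<bar>x\<bar>"
        using h False by (intro divide_right_mono sin_le_linear_minus_min) auto
      moreover have "\<dots> = h - h * min 1 ((h * x)\<^sup>2) / 9"
        using False by (simp add: diff_divide_distrib power_mult_distrib)
      ultimately show ?thesis by linarith
    qed
    ultimately show ?thesis by (simp add: ennreal_leI)
  qed simp
  have "ennreal (h / 9 * expectation (\<lambda>x. min 1 ((h * x)\<^sup>2)))
      = (\<integral>\<^sup>+x. ennreal (h * min 1 ((h * x)\<^sup>2) / 9) \<partial>M)"
    using h int by (subst nn_integral_eq_integral) auto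
  also have "\<dots> \<le> (\<integral>\<^sup>+x. (\<integral>\<^sup>+s. ennreal (1 - cos (s * x)) * indicator {0..h} s \<partial>lborel) \<partial>M)"
    by (intro nn_integral_mono low)
  also have "\<dots> = (\<integral>\<^sup>+s. (\<integral>\<^sup>+x. ennreal (1 - cos (s * x)) * indicator {0..h} s \<partial>M) \<partial>lborel)"
    by (rule P.Fubini'[symmetric]) measurable
  also have "\<dots> = (\<integral>\<^sup>+s. ennreal (1 - Re (char M s)) * indicator {0..h} s \<partial>lborel)"
    by (intro nn_integral_cong)
       (simp add: one_minus_Re_char nn_integral_eq_integral integrable_cos nn_integral_multc)
  also have "\<dots> \<le> (\<integral>\<^sup>+s. ennreal \<eta> * indicator {0..h} s \<partial>lborel)"
    by (intro nn_integral_mono) (auto simp: \<eta> ennreal_leI split: split_indicator)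
  also have "\<dots> = ennreal (h * \<eta>)"
    using h \<eta>0 by (simp add: nn_integral_cmult_indicator ennreal_mult' mult.commute)
  finally have "h / 9 * expectation (\<lambda>x. min 1 ((h * x)\<^sup>2)) \<le> h * \<eta>"
    using h \<eta>0 by (subst (asm) ennreal_le_iff) auto
  then show ?thesis using h by (simp add: field_simps)
qed

end

text \<open>
  The quotient of \<open>char (l n)\<close> and \<open>exp (g / n)\<close> is a continuous function on a connected set with values
  among the \<open>n\<close>-th roots of unity, so it is constant, and it equals \<open>1\<close> at \<open>0\<close>.
\<close>

lemma char_roots_eq_exp_on:
  fixes \<phi> :: "real \<Rightarrow> complex"
  assumes l: "\<And>n::nat. n \<ge> 1 \<Longrightarrow> real_distribution (l n)"
    and root: "\<And>n s. n \<ge> 1 \<Longrightarrow> char (l n) s ^ n = \<phi> s"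
    and S: "convex S" "0 \<in> S" and nz: "\<And>s. s \<in> S \<Longrightarrow> \<phi> s \<noteq> 0"
  obtains g where "continuous_on S g" "g 0 = 0"
    "\<And>n s. n \<ge> 1 \<Longrightarrow> s \<in> S \<Longrightarrow> char (l n) s = exp (g s / of_nat n)"
proof -
  have cont_char: "continuous_on S (char (l n))" if "n \<ge> 1" for n
    using real_distribution.isCont_char[OF l[OF that]] by (simp add: continuous_at_imp_continuous_on)
  have char0: "char (l n) 0 = 1" if "n \<ge> 1" for n
    by (rule real_distribution.char_zero[OF l[OF that]])
  have \<phi>: "\<phi> = char (l 1)" using root[of 1] by auto
  then have "continuous_on S \<phi>" using cont_char[of 1] by simp
  then obtain g0 where g0: "continuous_on S g0" "\<And>s. s \<in> S \<Longrightarrow> \<phi> s = exp (g0 s)"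
    by (rule continuous_logarithm_on_contractible[OF _ convex_imp_contractible[OF S(1)] nz]) auto
  define g where "g s = g0 s - g0 0" for s
  have "exp (g0 0) = 1"
    using g0(2)[OF S(2)] char0[of 1] by (simp add: \<phi>)
  then have g: "\<phi> s = exp (g s)" if "s \<in> S" for s
    using g0(2)[OF that] by (simp add: g_def exp_diff)
  have g_cont: "continuous_on S g"
    unfolding g_def by (intro continuous_intros g0)
  show thesis
  proof (rule that[of g])
    show "g 0 = 0" by (simp add: g_def)
    fix n :: nat and s assume n: "n \<ge> 1" and s: "s \<in> S"
    define q where "q s = char (l n) s * exp (- g s / of_nat n)" for s
    have q1: "q s ^ n = 1" if "s \<in> S" for s
    proof -
      have "q s ^ n = \<phi> s * exp (- g s / of_nat n) ^ n"
        using root[OF n] by (simp add: q_def power_mult_distrib)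
      also have "exp (- g s / of_nat n) ^ n = exp (- g s)"
        using n by (simp flip: exp_of_nat_mult)
      finally show ?thesis using g[OF that] by (simp flip: exp_add)
    qed
    have "q constant_on S"
    proof (rule continuous_finite_range_constant)
      show "connected S" by (rule convex_connected[OF S(1)])
      show "continuous_on S q"
        unfolding q_def using n by (intro continuous_intros cont_char g_cont) auto
      have "finite {z::complex. z ^ n = 1}"
        using card_complex_roots_unity[OF n] n by (intro card_ge_0_finite) simp
      then show "finite (q ` S)"
        by (rule finite_subset[rotated]) (use q1 in auto)
    qed
    then have "q s = q 0"
      using s S(2) by (auto simp: constant_on_def)
    also have "q 0 = 1" using char0[OF n] by (simp add: q_def g_def)
    finally show "char (l n) s = exp (g s / of_nat n)"
      by (simp add: q_def exp_minus field_simps)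
  qed (fact g_cont)
qed

lemma norm_exp_minus_one_le: "norm (exp z - 1) \<le> exp (norm z) * norm (z :: complex)"
  using Taylor_exp_field[of z 0] by simp

text \<open>
  Near \<open>0\<close> the function \<open>\<phi>\<close> has a continuous logarithm, so \<open>char (l n) t\<close> tends to \<open>1\<close> there. The
  doubling inequality propagates this to \<open>char (l n) (2 ^ k * t)\<close>, for fixed \<open>k\<close>: for large \<open>n\<close> it is
  nonzero, and so is its \<open>n\<close>-th power.
\<close>

lemma inf_divisible_char_nonzero:
  fixes \<phi> :: "real \<Rightarrow> complex"
  assumes l: "\<And>n::nat. n \<ge> 1 \<Longrightarrow> real_distribution (l n)"
    and root: "\<And>n s. n \<ge> 1 \<Longrightarrow> char (l n) s ^ n = \<phi> s"
  shows "\<phi> s \<noteq> 0"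
proof -
  have \<phi>: "\<phi> = char (l 1)" using root[of 1] by auto
  have "isCont \<phi> 0" "\<phi> 0 = 1"
    unfolding \<phi> using l[of 1] by (auto intro: real_distribution.isCont_char simp: real_distribution.char_zero)
  then have "(\<phi> \<longlongrightarrow> \<phi> 0) (nhds 0)" "\<phi> 0 \<noteq> 0"
    unfolding isCont_def tendsto_at_iff_tendsto_nhds by simp_all
  then have "\<forall>\<^sub>F s in nhds 0. \<phi> s \<noteq> 0"
    by (rule tendsto_imp_eventually_ne)
  then obtain d where d: "d > 0" "\<And>s. \<bar>s\<bar> < d \<Longrightarrow> \<phi> s \<noteq> 0"
    by (auto simp: eventually_nhds_metric dist_real_def)
  obtain g where g: "\<And>n s. n \<ge> 1 \<Longrightarrow> s \<in> {- d<..<d} \<Longrightarrow> char (l n) s = exp (g s / of_nat n)"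
    using d by (rule_tac char_roots_eq_exp_on[OF l root, of "{- d<..<d}"]) auto
  obtain k where k: "\<bar>s\<bar> / d < 2 ^ k"
    using real_arch_pow[of 2 "\<bar>s\<bar> / d"] by auto
  define t where "t = s / 2 ^ k"
  have s: "s = 2 ^ k * t" and t: "t \<in> {- d<..<d}"
    using k d(1) by (auto simp: t_def field_simps abs_less_iff)
  have "(\<lambda>n. exp (g t / of_nat n)) \<longlonglongrightarrow> exp 0"
    by (intro tendsto_intros lim_const_over_n)
  then have "(\<lambda>n. 4 ^ k * (1 - Re (exp (g t / of_nat n)))) \<longlonglongrightarrow> 4 ^ k * (1 - Re (exp 0))"
    by (intro tendsto_intros)
  then have "\<forall>\<^sub>F n in sequentially. 4 ^ k * (1 - Re (exp (g t / of_nat n))) < 1"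
    by (rule order_tendstoD) simp
  then have "\<forall>\<^sub>F n in sequentially. n \<ge> 1 \<and> 4 ^ k * (1 - Re (exp (g t / of_nat n))) < 1"
    using eventually_ge_at_top[of 1] by eventually_elim auto
  then obtain n :: nat where n: "n \<ge> 1" "4 ^ k * (1 - Re (exp (g t / of_nat n))) < 1"
    by (auto simp: eventually_sequentially)
  have "1 - Re (char (l n) s) \<le> 4 ^ k * (1 - Re (char (l n) t))"
    unfolding s by (rule real_distribution.one_minus_Re_char_pow2[OF l[OF n(1)]])
  then have "char (l n) s \<noteq> 0"
    using n g[OF n(1) t] by auto
  then show ?thesis
    using root[OF n(1), of s] by auto
qed

lemma char_roots_eq_exp:
  fixes \<phi> :: "real \<Rightarrow> complex"
  assumes l: "\<And>n::nat. n \<ge> 1 \<Longrightarrow> real_distribution (l n)"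
    and root: "\<And>n s. n \<ge> 1 \<Longrightarrow> char (l n) s ^ n = \<phi> s"
  obtains g where "continuous_on UNIV g" "g 0 = 0"
    "\<And>n s. n \<ge> 1 \<Longrightarrow> char (l n) s = exp (g s / of_nat n)"
  by (rule char_roots_eq_exp_on[OF l root, of UNIV])
     (use inf_divisible_char_nonzero[OF l root] in auto)

lemma norm_scaled_exp_minus_one_le:
  assumes "n \<ge> 1"
  shows "n * norm (exp (z / of_nat n) - 1 :: complex) \<le> exp (norm z) * norm z"
proof -
  have "n * norm (exp (z / of_nat n) - 1) \<le> n * (exp (norm (z / of_nat n)) * norm (z / of_nat n))"
    by (intro mult_left_mono norm_exp_minus_one_le) auto
  also have "\<dots> = exp (norm z / n) * norm z"
    using assms by (simp add: norm_divide)
  also have "\<dots> \<le> exp (norm z) * norm z"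
    using assms by (intro mult_right_mono) (auto simp: divide_le_eq mult_le_cancel_left1)
  finally show ?thesis .
qed

lemma scaled_exp_minus_one_tendsto:
  "(\<lambda>n. of_nat n * (exp (z / of_nat n) - 1 :: complex)) \<longlonglongrightarrow> z"
proof -
  have "(\<lambda>n. of_nat n * (exp (z / of_nat n) - 1) - z) \<longlonglongrightarrow> 0"
  proof (rule tendsto_norm_zero_cancel, rule tendsto_sandwich[OF _ _ tendsto_const])
    show "(\<lambda>n. exp (norm z) * (norm z)\<^sup>2 / of_nat n) \<longlonglongrightarrow> 0"
      by (rule lim_const_over_n)
    show "\<forall>\<^sub>F n in sequentially. norm (of_nat n * (exp (z / of_nat n) - 1) - z)
        \<le> exp (norm z) * (norm z)\<^sup>2 / of_nat n"
      using eventually_ge_at_top[of 1]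
    proof eventually_elim
      case (elim n)
      have "of_nat n * (exp (z / of_nat n) - 1) - z
          = of_nat n * (exp (z / of_nat n) - (\<Sum>k\<le>1. (z / of_nat n) ^ k / fact k))"
        using elim by (simp add: field_simps)
      then have "norm (of_nat n * (exp (z / of_nat n) - 1) - z)
          \<le> n * (exp (norm (z / of_nat n)) * norm (z / of_nat n) ^ 2 / fact 1)"
        using Taylor_exp_field[of "z / of_nat n" 1]
        by (simp add: norm_mult mult_left_mono numeral_2_eq_2 del: sum.atMost_Suc)
      also have "\<dots> = exp (norm z / n) * ((norm z)\<^sup>2 / n)"
        using elim by (simp add: norm_divide power2_eq_square)
      also have "\<dots> \<le> exp (norm z) * ((norm z)\<^sup>2 / n)"
        using elim by (intro mult_right_mono) (auto simp: divide_le_eq mult_le_cancel_left1)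
      finally show ?case by simp
    qed
  qed simp
  then show ?thesis by (simp add: LIM_zero_iff)
qed

section \<open>Sums and Jordan decompositions of measures\<close>

text \<open>
  \<open>D\<close> is the sum of the two measures; the two Radon-Nikodym densities add up to \<open>1\<close> almost everywhere.
\<close>

lemma finite_measures_common_density:
  assumes M: "finite_measure M" and N: "finite_measure N" and sets_N: "sets N = sets M"
  obtains D and f :: "'a \<Rightarrow> real" where "finite_measure D" "sets D = sets M"
    "f \<in> borel_measurable M" "\<And>x. 0 \<le> f x" "\<And>x. f x \<le> 1"
    "M = density D (\<lambda>x. ennreal (f x))" "N = density D (\<lambda>x. ennreal (1 - f x))"
proof -
  interpret M: finite_measure M by fact
  interpret N: finite_measure N by fact
  define D where "D = measure_of (space M) (sets M) (\<lambda>A. emeasure M A + emeasure N A)"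
  have sets_D [measurable_cong, simp]: "sets D = sets M"
    unfolding D_def by simp
  have D: "emeasure D A = emeasure M A + emeasure N A" if "A \<in> sets M" for A
    unfolding D_def
  proof (rule emeasure_measure_of_sigma)
    show "countably_additive (sets M) (\<lambda>A. emeasure M A + emeasure N A)"
      unfolding countably_additive_def
      using sets_N by (auto simp: suminf_add[symmetric] suminf_emeasure)
  qed (use that in \<open>auto simp: sets.sigma_algebra_axioms positive_def\<close>)
  have fin: "finite_measure D"
    using D[OF sets.top[of M]] sets_eq_imp_space_eq[OF sets_D] sets_eq_imp_space_eq[OF sets_N]
    by (intro finite_measureI) (simp add: M.emeasure_finite N.emeasure_finite)
  interpret D: finite_measure D by fact
  have "absolutely_continuous D M" "absolutely_continuous D N"
    unfolding absolutely_continuous_def null_sets_def using D sets_N by auto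
  then obtain f g where fg [measurable]: "f \<in> borel_measurable D" "g \<in> borel_measurable D"
    and f: "density D f = M" and g: "density D g = N"
    using D.Radon_Nikodym[of M] D.Radon_Nikodym[of N] sets_N by auto
  have "density D (\<lambda>x. f x + g x) = density D (\<lambda>_. 1)"
  proof (rule measure_eqI)
    fix A assume "A \<in> sets (density D (\<lambda>x. f x + g x))"
    then have A: "A \<in> sets D" by simp
    then have "emeasure (density D (\<lambda>x. f x + g x)) A = emeasure M A + emeasure N A"
      using emeasure_density_add[OF A fg] f g by simp
    then show "emeasure (density D (\<lambda>x. f x + g x)) A = emeasure (density D (\<lambda>_. 1)) A"
      using A D by (simp add: density_1)
  qed simp
  then have "AE x in D. f x + g x = 1"
    by (intro D.density_unique) auto
  then have AE: "AE x in D. f x = ennreal (enn2real (min 1 (f x)))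
      \<and> g x = ennreal (1 - enn2real (min 1 (f x)))"
  proof eventually_elim
    case (elim x)
    then have "f x \<le> 1" "g x \<le> 1"
      by (metis le_iff_add, metis add.commute le_iff_add)
    then obtain a b where ab: "f x = ennreal a" "g x = ennreal b" "0 \<le> a" "0 \<le> b"
      by (metis ennreal_cases ennreal_one_less_top neq_top_trans order.strict_implies_not_eq)
    then have "ennreal (a + b) = ennreal 1" using elim by simp
    then have "a + b = 1" using ab by (subst (asm) ennreal_inj) auto
    then show ?case using ab by (auto simp: min_def)
  qed
  show thesis
  proof (rule that[of D "\<lambda>x. enn2real (min 1 (f x))"])
    show "finite_measure D" "sets D = sets M" by fact+
    show "(\<lambda>x. enn2real (min 1 (f x))) \<in> borel_measurable M"
      using fg(1) by (simp add: measurable_cong_sets[OF sets_D refl])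
    fix x
    have "enn2real (min 1 (f x)) \<le> enn2real 1"
      by (intro enn2real_mono) auto
    then show "enn2real (min 1 (f x)) \<le> 1" by simp
  next
    show "M = density D (\<lambda>x. ennreal (enn2real (min 1 (f x))))"
      unfolding f[symmetric] using AE by (intro density_cong) auto
    show "N = density D (\<lambda>x. ennreal (1 - enn2real (min 1 (f x))))"
      unfolding g[symmetric] using AE by (intro density_cong) auto
  qed simp
qed

text \<open>
  Writing both measures as densities with respect to \<open>D\<close> makes additivity of the integral a matter of
  adding integrands.
\<close>

lemma finite_measure_sum:
  fixes M N :: "'a measure"
  assumes "finite_measure M" "finite_measure N" "sets N = sets M"
  obtains D where "finite_measure D" "sets D = sets M"
    "\<And>A. emeasure D A = emeasure M A + emeasure N A"
    "\<And>(F :: 'a \<Rightarrow> complex) C. F \<in> borel_measurable M \<Longrightarrow> (\<And>x. norm (F x) \<le> C) \<Longrightarrow>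
       integral\<^sup>L D F = integral\<^sup>L M F + integral\<^sup>L N F"
proof -
  obtain D and f :: "'a \<Rightarrow> real" where D: "finite_measure D" and sets_D: "sets D = sets M"
    and f: "f \<in> borel_measurable M" "\<And>x. 0 \<le> f x" "\<And>x. f x \<le> 1"
    and M: "M = density D (\<lambda>x. ennreal (f x))" and N: "N = density D (\<lambda>x. ennreal (1 - f x))"
    by (rule finite_measures_common_density[OF assms]) blast
  interpret D: finite_measure D by fact
  have [measurable]: "f \<in> borel_measurable D"
    using f(1) by (simp add: measurable_cong_sets[OF sets_D refl])
  show thesis
  proof (rule that[OF D sets_D])
    fix A
    show "emeasure D A = emeasure M A + emeasure N A"
    proof (cases "A \<in> sets D")
      case True
      have "emeasure M A + emeasure N A = emeasure (density D (\<lambda>x. ennreal (f x) + ennreal (1 - f x))) A"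
        unfolding M N by (rule emeasure_density_add[OF True]) measurable
      also have "(\<lambda>x. ennreal (f x) + ennreal (1 - f x)) = (\<lambda>_. 1)"
        using f by (simp flip: ennreal_plus)
      finally show ?thesis by (simp add: density_1)
    qed (simp add: emeasure_notin_sets M N)
  next
    fix F :: "'a \<Rightarrow> complex" and C
    assume "F \<in> borel_measurable M" and C: "\<And>x. norm (F x) \<le> C"
    then have [measurable]: "F \<in> borel_measurable D"
      by (simp add: measurable_cong_sets[OF sets_D refl])
    have C0: "0 \<le> C" using C[of undefined] norm_ge_zero order_trans by blast
    have int: "integrable D (\<lambda>x. k x *\<^sub>R F x)"
      if [measurable]: "k \<in> borel_measurable D" and k: "\<And>x. 0 \<le> k x" "\<And>x. k x \<le> 1" for k :: "_ \<Rightarrow> real"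
      using mult_mono[OF k(2) C] k(1) C0
      by (intro D.integrable_const_bound[of _ C] AE_I2) auto
    have "integral\<^sup>L M F + integral\<^sup>L N F = (CLINT x|D. f x *\<^sub>R F x) + (CLINT x|D. (1 - f x) *\<^sub>R F x)"
      unfolding M N using f by (simp add: integral_density)
    also have "\<dots> = (CLINT x|D. f x *\<^sub>R F x + (1 - f x) *\<^sub>R F x)"
      using f by (intro Bochner_Integration.integral_add[symmetric] int) auto
    also have "\<dots> = integral\<^sup>L D F"
      by (simp flip: scaleR_left_distrib)
    finally show "integral\<^sup>L D F = integral\<^sup>L M F + integral\<^sup>L N F" by simp
  qed
qed

text \<open>
  The set \<open>P\<close> is a Hahn decomposition for the difference: the supremum in \<open>pos_part\<close> is attained at
  \<open>B \<inter> P\<close>.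
\<close>

lemma pos_part_diff_measure:
  assumes \<A>: "\<A> \<subseteq> sets m" "\<A> \<subseteq> sets m'" "\<And>E. E \<in> \<A> \<Longrightarrow> emeasure m E < \<infinity>"
    and B: "B \<in> \<A>" "B \<inter> P \<in> \<A>" "B - P \<in> \<A>"
    and P: "emeasure m (B - P) = 0" "emeasure m' (B \<inter> P) = 0"
  shows "pos_part (\<lambda>E. measure m E - measure m' E) \<A> B = emeasure m B"
  unfolding pos_part_def
proof (rule antisym)
  have em: "emeasure m E = ennreal (measure m E)" if "E \<in> \<A>" for E
    using \<A>(3)[OF that] by (intro emeasure_eq_ennreal_measure) (auto simp: less_top)
  show "(SUP E\<in>{E \<in> \<A>. E \<subseteq> B}. ennreal (measure m E - measure m' E)) \<le> emeasure m B"
  proof (rule SUP_least)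
    fix E assume E: "E \<in> {E \<in> \<A>. E \<subseteq> B}"
    have "ennreal (measure m E - measure m' E) \<le> ennreal (measure m E)"
      by (intro ennreal_leI) simp
    also have "\<dots> = emeasure m E" using E em by simp
    also have "\<dots> \<le> emeasure m B" using E B \<A> by (intro emeasure_mono) auto
    finally show "ennreal (measure m E - measure m' E) \<le> emeasure m B" .
  qed
  have "emeasure m B = emeasure m (B \<inter> P) + emeasure m (B - P)"
    using B \<A>(1) by (subst plus_emeasure) (auto simp: Int_Diff_Un)
  also have "\<dots> = ennreal (measure m (B \<inter> P) - measure m' (B \<inter> P))"
    using P em[OF B(2)] by (simp add: measure_def)
  also have "\<dots> \<le> (SUP E\<in>{E \<in> \<A>. E \<subseteq> B}. ennreal (measure m E - measure m' E))"
    using B by (intro SUP_upper) auto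
  finally show "emeasure m B \<le> (SUP E\<in>{E \<in> \<A>. E \<subseteq> B}. ennreal (measure m E - measure m' E))" .
qed

text \<open>
  With a Hahn decomposition \<open>P\<close>, the partition of \<open>B\<close> into \<open>B \<inter> P\<close> and \<open>B - P\<close> is optimal.
\<close>

lemma total_variation_diff_measure:
  assumes \<A>: "\<A> \<subseteq> sets m" "\<A> \<subseteq> sets m'" "\<A> \<subseteq> sets v"
    and v: "\<And>E. E \<in> \<A> \<Longrightarrow> emeasure v E = emeasure m E + emeasure m' E"
      "\<And>E. E \<in> \<A> \<Longrightarrow> emeasure v E < \<infinity>"
    and B: "B \<in> \<A>" "B \<inter> P \<in> \<A>" "B - P \<in> \<A>"
    and P: "emeasure m (B - P) = 0" "emeasure m' (B \<inter> P) = 0"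
  shows "total_variation (\<lambda>E. measure m E - measure m' E) \<A> B = emeasure v B"
  unfolding total_variation_def
proof (rule antisym)
  let ?\<nu> = "\<lambda>E. measure m E - measure m' E"
  have fin: "emeasure m E < \<infinity>" "emeasure m' E < \<infinity>" if "E \<in> \<A>" for E
    using v(2)[OF that] unfolding v(1)[OF that] by (auto simp: less_top)
  have em: "emeasure m E = ennreal (measure m E)" "emeasure m' E = ennreal (measure m' E)"
    if "E \<in> \<A>" for E
    using fin[OF that] by (auto intro!: emeasure_eq_ennreal_measure simp: less_top)
  have ev: "emeasure v E = ennreal (measure m E + measure m' E)" if "E \<in> \<A>" for E
    using v(1)[OF that] em[OF that] by simp
  show "(SUP Q\<in>{Q. finite Q \<and> Q \<subseteq> \<A> \<and> partition_on B Q}. ennreal (\<Sum>E\<in>Q. \<bar>?\<nu> E\<bar>)) \<le> emeasure v B"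
  proof (rule SUP_least)
    fix Q assume "Q \<in> {Q. finite Q \<and> Q \<subseteq> \<A> \<and> partition_on B Q}"
    then have Q: "finite Q" "Q \<subseteq> \<A>" "\<Union>Q = B" "disjoint Q"
      by (auto simp: partition_on_def)
    have "ennreal (\<Sum>E\<in>Q. \<bar>?\<nu> E\<bar>) = (\<Sum>E\<in>Q. ennreal \<bar>?\<nu> E\<bar>)"
      by (simp add: sum_ennreal)
    also have "\<dots> \<le> (\<Sum>E\<in>Q. emeasure v E)"
    proof (rule sum_mono)
      fix E assume "E \<in> Q"
      then have "E \<in> \<A>" using Q by auto
      then show "ennreal \<bar>?\<nu> E\<bar> \<le> emeasure v E"
        unfolding ev[OF \<open>E \<in> \<A>\<close>]
        by (intro ennreal_leI) (simp add: abs_le_iff)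
    qed
    also have "\<dots> = emeasure v (\<Union>E\<in>Q. E)"
      using Q \<A>(3) by (intro sum_emeasure) (auto simp: disjoint_family_on_def disjoint_def)
    finally show "ennreal (\<Sum>E\<in>Q. \<bar>?\<nu> E\<bar>) \<le> emeasure v B"
      using Q(3) by simp
  qed
  show "emeasure v B \<le> (SUP Q\<in>{Q. finite Q \<and> Q \<subseteq> \<A> \<and> partition_on B Q}. ennreal (\<Sum>E\<in>Q. \<bar>?\<nu> E\<bar>))"
  proof (cases "B = {}")
    case False
    (* The cells of a partition are nonempty, hence the removal of {}. *)
    define Q where "Q = {B \<inter> P, B - P} - {{}}"
    have "partition_on B Q"
      unfolding partition_on_def Q_def disjoint_def by auto
    then have Q: "Q \<in> {Q. finite Q \<and> Q \<subseteq> \<A> \<and> partition_on B Q}"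
      using B by (auto simp: Q_def)
    have ne: "B \<inter> P \<noteq> B - P" using False by auto
    have "(\<Sum>E\<in>Q. \<bar>?\<nu> E\<bar>) = (\<Sum>E\<in>{B \<inter> P, B - P}. \<bar>?\<nu> E\<bar>)"
      unfolding Q_def by (intro sum.mono_neutral_left) auto
    also have "\<dots> = measure m (B \<inter> P) + measure m' (B - P)"
      using ne P by (simp add: measure_def)
    also have "ennreal \<dots> = emeasure v (B \<inter> P) + emeasure v (B - P)"
      using v(1)[OF B(2)] v(1)[OF B(3)] P em[OF B(2)] em[OF B(3)] by simp
    also have "\<dots> = emeasure v B"
      using B \<A>(3) by (subst plus_emeasure) (auto simp: Int_Diff_Un)
    finally have "emeasure v B = ennreal (\<Sum>E\<in>Q. \<bar>?\<nu> E\<bar>)" by simp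
    then show ?thesis by (intro SUP_upper2[OF Q]) simp
  qed simp
qed

lemma finite_signed_measure_diff_measure:
  assumes \<A>: "\<A> \<subseteq> sets m" "\<A> \<subseteq> sets m'"
    and UN: "\<And>E :: nat \<Rightarrow> 'a set. range E \<subseteq> \<A> \<Longrightarrow> (\<Union>n. E n) \<in> \<A>"
    and fin: "\<And>E. E \<in> \<A> \<Longrightarrow> emeasure m E < \<infinity>" "\<And>E. E \<in> \<A> \<Longrightarrow> emeasure m' E < \<infinity>"
  shows "finite_signed_measure \<A> (\<lambda>E. measure m E - measure m' E)"
  unfolding finite_signed_measure_def
proof (intro conjI allI impI)
  fix E :: "nat \<Rightarrow> 'a set" assume E: "range E \<subseteq> \<A>" "disjoint_family E"
  show "(\<lambda>n. measure m (E n) - measure m' (E n)) sums (measure m (\<Union>n. E n) - measure m' (\<Union>n. E n))"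
    using E \<A> fin[OF UN[OF E(1)]]
    by (intro sums_diff measure_UNION) (auto simp: less_top)
qed simp

section \<open>The Levy kernel\<close>

lemma borel_measurable_R_norm [measurable]:
  "(\<lambda>x. R_norm I x) \<in> borel_measurable (R_space I)"
  unfolding L2_set_def by measurable

definition levy_weight :: "'i set \<Rightarrow> ('i \<Rightarrow> real) \<Rightarrow> real" where
  "levy_weight I x = min 1 ((R_norm I x)\<^sup>2)"

lemma levy_weight_bounds [simp]: "0 \<le> levy_weight I x" "levy_weight I x \<le> 1"
  by (simp_all add: levy_weight_def)

lemma borel_measurable_levy_weight [measurable]:
  "levy_weight I \<in> borel_measurable (R_space I)"
  unfolding levy_weight_def by measurable

lemma abs_R_inner_le: "\<bar>R_inner I x y\<bar> \<le> R_norm I x * R_norm I y"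
proof -
  have "\<bar>R_inner I x y\<bar> \<le> (\<Sum>i\<in>I. \<bar>x i\<bar> * \<bar>y i\<bar>)"
    unfolding R_inner_def abs_mult[symmetric] by (rule sum_abs)
  also have "\<dots> \<le> R_norm I x * R_norm I y" by (rule L2_set_mult_ineq)
  finally show ?thesis .
qed

text \<open>
  This is \<open>R_inner I \<theta> (trunc I x)\<close> (lemma \<open>R_inner_trunc\<close>), in a form that is visibly linear in
  \<open>\<theta>\<close> and continuous in \<open>x\<close>.
\<close>

definition trunc_inner :: "'i set \<Rightarrow> ('i \<Rightarrow> real) \<Rightarrow> ('i \<Rightarrow> real) \<Rightarrow> real" where
  "trunc_inner I \<theta> x = R_inner I \<theta> x / max 1 (R_norm I x)"

lemma R_inner_trunc: "R_inner I \<theta> (trunc I x) = trunc_inner I \<theta> x"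
  by (auto simp: trunc_inner_def trunc_def max_def R_inner_def sum_divide_distrib)

lemma borel_measurable_R_inner [measurable]: "R_inner I \<theta> \<in> borel_measurable (R_space I)"
  unfolding R_inner_def by measurable

lemma borel_measurable_trunc_inner [measurable]: "trunc_inner I \<theta> \<in> borel_measurable (R_space I)"
  unfolding trunc_inner_def by measurable

text \<open>
  The left side is the squared norm of the truncation of \<open>x\<close>.
\<close>

lemma norm_div_max_sq: "(R_norm I x / max 1 (R_norm I x))\<^sup>2 = levy_weight I x"
proof (cases "R_norm I x \<le> 1")
  case True
  then have "(R_norm I x)\<^sup>2 \<le> 1\<^sup>2" by (intro power_mono) auto
  then show ?thesis using True by (simp add: levy_weight_def)
next
  case False
  then have "1\<^sup>2 \<le> (R_norm I x)\<^sup>2" by (intro power_mono) auto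
  then show ?thesis using False by (simp add: levy_weight_def)
qed

lemma abs_trunc_inner_mult_le:
  "\<bar>trunc_inner I \<theta> x * trunc_inner I \<eta> x\<bar> \<le> R_norm I \<theta> * R_norm I \<eta> * levy_weight I x"
proof -
  let ?u = "R_norm I x / max 1 (R_norm I x)"
  have *: "\<bar>trunc_inner I \<theta> x\<bar> \<le> R_norm I \<theta> * ?u" for \<theta>
  proof -
    have "\<bar>R_inner I \<theta> x\<bar> / max 1 (R_norm I x) \<le> (R_norm I \<theta> * R_norm I x) / max 1 (R_norm I x)"
      by (intro divide_right_mono abs_R_inner_le) auto
    then show ?thesis by (simp add: trunc_inner_def abs_divide)
  qed
  have "\<bar>trunc_inner I \<theta> x\<bar> * \<bar>trunc_inner I \<eta> x\<bar> \<le> (R_norm I \<theta> * ?u) * (R_norm I \<eta> * ?u)"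
    by (intro mult_mono *) auto
  also have "\<dots> = R_norm I \<theta> * R_norm I \<eta> * ?u\<^sup>2" by (simp add: power2_eq_square)
  finally show ?thesis unfolding norm_div_max_sq by (simp add: abs_mult)
qed

lemma abs_trunc_inner_le: "\<bar>trunc_inner I \<theta> x\<bar> \<le> R_norm I \<theta>"
proof (rule power2_le_imp_le)
  have "(trunc_inner I \<theta> x)\<^sup>2 \<le> (R_norm I \<theta>)\<^sup>2 * levy_weight I x"
    using abs_trunc_inner_mult_le[of I \<theta> x \<theta>] by (simp add: power2_eq_square)
  also have "\<dots> \<le> (R_norm I \<theta>)\<^sup>2 * 1" by (intro mult_left_mono) auto
  finally show "\<bar>trunc_inner I \<theta> x\<bar>\<^sup>2 \<le> (R_norm I \<theta>)\<^sup>2" by simp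
qed simp

text \<open>
  The integrand of the Levy-Khintchine exponent.
\<close>

definition levy_kernel :: "'i set \<Rightarrow> ('i \<Rightarrow> real) \<Rightarrow> ('i \<Rightarrow> real) \<Rightarrow> complex" where
  "levy_kernel I \<theta> x = iexp (R_inner I \<theta> x) - 1 - \<i> * of_real (R_inner I \<theta> (trunc I x))"

lemma borel_measurable_levy_kernel [measurable]: "levy_kernel I \<theta> \<in> borel_measurable (R_space I)"
  unfolding levy_kernel_def R_inner_trunc by measurable

lemma norm_levy_kernel_le:
  "norm (levy_kernel I \<theta> x) \<le> (2 + R_norm I \<theta> + (R_norm I \<theta>)\<^sup>2) * levy_weight I x"
proof (cases "R_norm I x \<le> 1")
  case True
  let ?u = "R_inner I \<theta> x"
  have w: "levy_weight I x = (R_norm I x)\<^sup>2"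
    using norm_div_max_sq[of x I] True by simp
  have "levy_kernel I \<theta> x = iexp ?u - (\<Sum>k\<le>1. (\<i> * ?u) ^ k / fact k)"
    using True by (simp add: levy_kernel_def trunc_def)
  then have "norm (levy_kernel I \<theta> x) \<le> \<bar>?u\<bar>\<^sup>2 / 2"
    using iexp_approx1[of ?u 1] by (simp add: numeral_2_eq_2 del: sum.atMost_Suc)
  also have "\<dots> \<le> (R_norm I \<theta> * R_norm I x)\<^sup>2 / 2"
    by (intro divide_right_mono power_mono abs_R_inner_le) auto
  also have "\<dots> \<le> (R_norm I \<theta>)\<^sup>2 * levy_weight I x"
    by (simp add: w power_mult_distrib)
  also have "\<dots> \<le> (2 + R_norm I \<theta> + (R_norm I \<theta>)\<^sup>2) * levy_weight I x"
    by (intro mult_right_mono) auto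
  finally show ?thesis .
next
  case False
  then have "1\<^sup>2 \<le> (R_norm I x)\<^sup>2" by (intro power_mono) auto
  then have w: "levy_weight I x = 1" by (simp add: levy_weight_def)
  have "norm (levy_kernel I \<theta> x) \<le> norm (iexp (R_inner I \<theta> x)) + norm (1 :: complex)
      + norm (\<i> * of_real (trunc_inner I \<theta> x))"
    unfolding levy_kernel_def R_inner_trunc by (intro norm_triangle_le_diff add_mono norm_triangle_ineq4) auto
  also have "\<dots> \<le> 2 + R_norm I \<theta>"
    using abs_trunc_inner_le[of I \<theta> x] by (simp add: norm_mult)
  finally show ?thesis using w by (simp add: add_increasing2)
qed

text \<open>
  The kernel \<open>levy_kernel I \<theta> x / levy_weight I x\<close> has limits at \<open>0\<close> that in general depend on the direction.
  Adding the quadratic term cancels them: the quotient then tends to \<open>0\<close>, its value at \<open>0\<close>.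
\<close>

definition levy_remainder :: "'i set \<Rightarrow> ('i \<Rightarrow> real) \<Rightarrow> ('i \<Rightarrow> real) \<Rightarrow> complex" where
  "levy_remainder I \<theta> x =
     (levy_kernel I \<theta> x + of_real ((trunc_inner I \<theta> x)\<^sup>2 / 2)) / of_real (levy_weight I x)"

lemma borel_measurable_levy_remainder [measurable]:
  "levy_remainder I \<theta> \<in> borel_measurable (R_space I)"
  unfolding levy_remainder_def by measurable

lemma norm_divide_levy_weight_le:
  fixes z :: complex
  assumes "norm z \<le> C * levy_weight I x" "0 \<le> C"
  shows "norm (z / of_real (levy_weight I x)) \<le> C"
  using assms levy_weight_bounds(1)[of I x]
  by (cases "levy_weight I x = 0") (auto simp: norm_divide divide_le_eq less_le)

lemma norm_levy_remainder_le:
  "norm (levy_remainder I \<theta> x) \<le> 2 + R_norm I \<theta> + 2 * (R_norm I \<theta>)\<^sup>2"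
  unfolding levy_remainder_def
proof (rule norm_divide_levy_weight_le)
  have "norm (complex_of_real ((trunc_inner I \<theta> x)\<^sup>2 / 2)) \<le> (R_norm I \<theta>)\<^sup>2 * levy_weight I x"
  proof -
    have "(trunc_inner I \<theta> x)\<^sup>2 \<le> (R_norm I \<theta>)\<^sup>2 * levy_weight I x"
      using abs_trunc_inner_mult_le[of I \<theta> x \<theta>] by (simp add: power2_eq_square)
    moreover have "0 \<le> (trunc_inner I \<theta> x)\<^sup>2" by simp
    moreover have "norm (complex_of_real ((trunc_inner I \<theta> x)\<^sup>2 / 2)) = (trunc_inner I \<theta> x)\<^sup>2 / 2"
      unfolding norm_of_real by simp
    ultimately show ?thesis by linarith
  qed
  with norm_levy_kernel_le[of I \<theta> x]
  have "norm (levy_kernel I \<theta> x + of_real ((trunc_inner I \<theta> x)\<^sup>2 / 2))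
      \<le> (2 + R_norm I \<theta> + (R_norm I \<theta>)\<^sup>2) * levy_weight I x + (R_norm I \<theta>)\<^sup>2 * levy_weight I x"
    by (intro norm_triangle_le add_mono)
  then show "norm (levy_kernel I \<theta> x + of_real ((trunc_inner I \<theta> x)\<^sup>2 / 2))
      \<le> (2 + R_norm I \<theta> + 2 * (R_norm I \<theta>)\<^sup>2) * levy_weight I x"
    by (simp add: algebra_simps)
qed simp

text \<open>
  Third order Taylor estimate of the exponential, divided by the second order weight.
\<close>

lemma norm_levy_remainder_near_zero:
  assumes "R_norm I x \<le> 1"
  shows "norm (levy_remainder I \<theta> x) \<le> (R_norm I \<theta>) ^ 3 * R_norm I x"
  unfolding levy_remainder_def
proof (rule norm_divide_levy_weight_le)
  let ?u = "R_inner I \<theta> x"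
  have w: "levy_weight I x = (R_norm I x)\<^sup>2"
    using norm_div_max_sq[of x I] assms by simp
  have "levy_kernel I \<theta> x + of_real ((trunc_inner I \<theta> x)\<^sup>2 / 2)
      = iexp ?u - (\<Sum>k\<le>2. (\<i> * ?u) ^ k / fact k)"
    using assms
    by (simp add: levy_kernel_def trunc_def trunc_inner_def numeral_2_eq_2 power2_eq_square algebra_simps)
  then have "norm (levy_kernel I \<theta> x + of_real ((trunc_inner I \<theta> x)\<^sup>2 / 2)) \<le> \<bar>?u\<bar> ^ 3 / fact 3"
    using iexp_approx1[of ?u 2] by (simp add: numeral_3_eq_3 numeral_2_eq_2 del: sum.atMost_Suc fact_Suc)
  also have "\<dots> \<le> \<bar>?u\<bar> ^ 3"
    by (simp add: fact_numeral)
  also have "\<dots> \<le> (R_norm I \<theta> * R_norm I x) ^ 3"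
    by (intro power_mono abs_R_inner_le) auto
  also have "\<dots> = R_norm I \<theta> ^ 3 * R_norm I x * levy_weight I x"
    by (simp add: w power_mult_distrib power3_eq_cube power2_eq_square)
  finally show "norm (levy_kernel I \<theta> x + of_real ((trunc_inner I \<theta> x)\<^sup>2 / 2))
      \<le> R_norm I \<theta> ^ 3 * R_norm I x * levy_weight I x" .
qed simp

lemma continuous_on_R_norm: "continuous_on UNIV (\<lambda>x :: 'i \<Rightarrow> real. R_norm I x)"
  unfolding L2_set_def
  by (intro continuous_intros continuous_on_product_coordinates)

lemma continuous_on_R_inner: "continuous_on UNIV (R_inner I \<theta>)"
  unfolding R_inner_def by (intro continuous_intros continuous_on_product_coordinates)

lemma continuous_on_levy_remainder: "continuous_on UNIV (levy_remainder I \<theta>)"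
proof -
  have "(levy_remainder I \<theta> \<longlongrightarrow> levy_remainder I \<theta> x) (at x)" for x
  proof (cases "R_norm I x = 0")
    case False
    then have w: "levy_weight I x \<noteq> 0" by (simp add: levy_weight_def min_def)
    have n: "((\<lambda>x. R_norm I x) \<longlongrightarrow> R_norm I x) (at x)" "(R_inner I \<theta> \<longlongrightarrow> R_inner I \<theta> x) (at x)"
      using continuous_on_R_norm[of I] continuous_on_R_inner[of I \<theta>]
      by (simp_all add: continuous_on_def)
    have "(levy_weight I \<longlongrightarrow> levy_weight I x) (at x)"
      unfolding levy_weight_def by (intro tendsto_intros n)
    moreover have "(trunc_inner I \<theta> \<longlongrightarrow> trunc_inner I \<theta> x) (at x)"
      unfolding trunc_inner_def by (intro tendsto_intros n) auto
    ultimately show ?thesis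
      unfolding levy_remainder_def levy_kernel_def R_inner_trunc
      using w by (intro tendsto_intros n) auto
  next
    case True
    then have 0: "levy_remainder I \<theta> x = 0" by (simp add: levy_remainder_def levy_weight_def)
    have lim: "((\<lambda>y. R_norm I y) \<longlongrightarrow> 0) (at x)"
      using continuous_on_R_norm[of I] True by (simp add: continuous_on_def) metis
    have "(levy_remainder I \<theta> \<longlongrightarrow> 0) (at x)"
    proof (rule Lim_null_comparison)
      show "\<forall>\<^sub>F y in at x. norm (levy_remainder I \<theta> y) \<le> R_norm I \<theta> ^ 3 * R_norm I y"
        using order_tendstoD(2)[OF lim zero_less_one]
        by eventually_elim (simp add: norm_levy_remainder_near_zero)
      show "((\<lambda>y. R_norm I \<theta> ^ 3 * R_norm I y) \<longlongrightarrow> 0) (at x)"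
        using tendsto_mult_left[OF lim, of "R_norm I \<theta> ^ 3"] by simp
    qed
    then show ?thesis by (simp add: 0)
  qed
  then show ?thesis by (simp add: continuous_on_def)
qed

section \<open>Differences of Levy measures\<close>

text \<open>
  In terms of a common dominating measure \<open>D\<close> with \<open>G\<close> of density \<open>f\<close> and \<open>G'\<close> of density \<open>1 - f\<close>, the
  difference of the Levy measures has density \<open>h = (2 f - 1) / w\<close>. The densities \<open>max 0 h\<close>,
  \<open>max 0 (- h)\<close> and \<open>\<bar>h\<bar>\<close> give its positive part, negative part and total variation, because
  \<open>{h > 0}\<close> is a Hahn decomposition. At the origin \<open>h = 0\<close>, by division by zero.
\<close>

lemma quasi_levy_type_difference:
  fixes G G' :: "('i \<Rightarrow> real) measure"
  assumes I: "finite I" and G: "finite_measure G" "sets G = sets (R_space I)"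
    and G': "finite_measure G'" "sets G' = sets (R_space I)"
  obtains \<nu> where "quasi_levy_type I \<nu>"
    "\<And>g C. g \<in> borel_measurable (R_space I) \<Longrightarrow> (\<And>x. norm (g x) \<le> C * levy_weight I x) \<Longrightarrow>
       q_integral I \<nu> g = (CLINT x|G. g x / of_real (levy_weight I x))
                        - (CLINT x|G'. g x / of_real (levy_weight I x))"
proof -
  let ?w = "levy_weight I"
  obtain D and f :: "('i \<Rightarrow> real) \<Rightarrow> real" where D: "finite_measure D" and "sets D = sets G"
    and "f \<in> borel_measurable G" and f01: "\<And>x. 0 \<le> f x" "\<And>x. f x \<le> 1"
    and G_eq: "G = density D (\<lambda>x. ennreal (f x))" and G'_eq: "G' = density D (\<lambda>x. ennreal (1 - f x))"
    by (rule finite_measures_common_density[OF G(1) G'(1) G'(2)[folded G(2)]]) blast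
  interpret D: finite_measure D by fact
  have sets_D [measurable_cong, simp]: "sets D = sets (R_space I)"
    using \<open>sets D = sets G\<close> G by simp
  have [measurable]: "f \<in> borel_measurable (R_space I)"
    using \<open>f \<in> borel_measurable G\<close> by (simp add: measurable_cong_sets[OF G(2) refl])
  define h where "h x = (2 * f x - 1) / ?w x" for x
  have h [measurable]: "h \<in> borel_measurable (R_space I)"
    unfolding h_def by measurable
  have hw: "\<bar>h x\<bar> * ?w x \<le> 1" for x
    using f01[of x] by (auto simp: h_def abs_divide abs_le_iff)
  define m where "m = density D (\<lambda>x. ennreal (h x))"
  define m' where "m' = density D (\<lambda>x. ennreal (- h x))"
  define v where "v = density D (\<lambda>x. ennreal \<bar>h x\<bar>)"
  have sets_m [simp]: "sets m = sets (R_space I)" "sets m' = sets (R_space I)" "sets v = sets (R_space I)"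
    by (simp_all add: m_def m'_def v_def)
  define P where "P = {x \<in> space (R_space I). 0 < h x}"
  have [measurable]: "P \<in> sets (R_space I)"
    unfolding P_def by measurable
  define \<nu> where "\<nu> = (\<lambda>E. measure m E - measure m' E)"
  have v_eq: "emeasure v E = emeasure m E + emeasure m' E" if "E \<in> sets (R_space I)" for E
  proof -
    have "ennreal \<bar>h x\<bar> = ennreal (h x) + ennreal (- h x)" for x
      by (cases "h x \<ge> 0") (auto simp: ennreal_neg)
    then show ?thesis
      unfolding v_def m_def m'_def using that by (subst emeasure_density_add) auto
  qed
  have null: "emeasure m (E - P) = 0" "emeasure m' (E \<inter> P) = 0" if "E \<in> sets (R_space I)" for E
  proof -
    have "E \<subseteq> space (R_space I)" using that by (rule sets.sets_into_space)
    then show "emeasure m (E - P) = 0" "emeasure m' (E \<inter> P) = 0"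
      unfolding m_def m'_def using that
      by (auto simp: emeasure_density nn_integral_0_iff_AE P_def not_less ennreal_neg
          split: split_indicator intro!: AE_I2)
  qed
  have zero: "emeasure m {R_zero I} = 0" "emeasure m' {R_zero I} = 0" "emeasure v {R_zero I} = 0"
  proof -
    have "R_norm I (R_zero I) = 0" by (simp add: L2_set_def R_zero_def)
    then have "h (R_zero I) = 0" by (simp add: h_def levy_weight_def)
    then have "emeasure (density D (\<lambda>x. ennreal (k (h x)))) {R_zero I} = 0"
      if [measurable]: "k \<in> borel_measurable borel" and "k 0 = 0" for k :: "real \<Rightarrow> real"
    proof (cases "{R_zero I} \<in> sets (R_space I)")
      case True
      then show ?thesis using that(2) \<open>h (R_zero I) = 0\<close>
        by (auto simp: emeasure_density nn_integral_0_iff_AE split: split_indicator intro!: AE_I2)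
    qed (simp add: emeasure_notin_sets)
    from this[of "\<lambda>t. t"] this[of uminus] this[of abs]
    show "emeasure m {R_zero I} = 0" "emeasure m' {R_zero I} = 0" "emeasure v {R_zero I} = 0"
      by (simp_all add: m_def m'_def v_def)
  qed
  have off: "sets_off I r \<subseteq> sets (R_space I)" for r
    by (auto simp: sets_off_def)
  have off_sub: "F \<in> sets_off I r" if "E \<in> sets_off I r" "F \<subseteq> E" "F \<in> sets (R_space I)" for E F r
    using that by (auto simp: sets_off_def)
  have offP: "E \<inter> P \<in> sets_off I r" "E - P \<in> sets_off I r" if "E \<in> sets_off I r" for E r
    using that off[of r] by (auto intro!: off_sub[OF that])
  have v_fin: "emeasure v E < \<infinity>" if E: "E \<in> sets_off I r" and r: "r > 0" for E r
  proof -
    have "emeasure v E \<le> (\<integral>\<^sup>+x. ennreal (1 / min 1 (r\<^sup>2)) * indicator E x \<partial>D)"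
      unfolding v_def
    proof (subst emeasure_density)
      show "(\<integral>\<^sup>+x. ennreal \<bar>h x\<bar> * indicator E x \<partial>D) \<le> (\<integral>\<^sup>+x. ennreal (1 / min 1 (r\<^sup>2)) * indicator E x \<partial>D)"
      proof (rule nn_integral_mono)
        fix x
        have "\<bar>h x\<bar> \<le> 1 / min 1 (r\<^sup>2)" if "x \<in> E"
        proof -
          have "r \<le> R_norm I x" using E that by (auto simp: sets_off_def not_less)
          then have "r\<^sup>2 \<le> (R_norm I x)\<^sup>2" using r by (intro power_mono) auto
          then have "min 1 (r\<^sup>2) \<le> ?w x" by (auto simp: levy_weight_def)
          then have "\<bar>h x\<bar> * min 1 (r\<^sup>2) \<le> \<bar>h x\<bar> * ?w x" by (intro mult_left_mono) auto
          with hw[of x] have "\<bar>h x\<bar> * min 1 (r\<^sup>2) \<le> 1" by simp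
          then show ?thesis using r by (subst pos_le_divide_eq) auto
        qed
        then show "ennreal \<bar>h x\<bar> * indicator E x \<le> ennreal (1 / min 1 (r\<^sup>2)) * indicator E x"
          by (auto intro: ennreal_leI split: split_indicator)
      qed
    qed (use E off in auto)
    also have "\<dots> = ennreal (1 / min 1 (r\<^sup>2)) * emeasure D E"
      using E off[of r] by (intro nn_integral_cmult_indicator) auto
    also have "\<dots> < \<infinity>"
      by (simp add: ennreal_mult_eq_top_iff less_top[symmetric])
    finally show ?thesis .
  qed
  have m_fin: "emeasure m E < \<infinity>" "emeasure m' E < \<infinity>" if "E \<in> sets_off I r" "r > 0" for E r
    using v_fin[OF that] v_eq[of E] that off[of r] by auto
  have ext_m: "extends_off I (pos_part \<nu>) m"
    unfolding extends_off_def \<nu>_def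
  proof (intro conjI allI impI ballI zero sets_m)
    fix r :: real and B assume r: "r > 0" "B \<in> sets_off I r"
    then show "emeasure m B = pos_part (\<lambda>E. measure m E - measure m' E) (sets_off I r) B"
      using off null m_fin offP by (intro pos_part_diff_measure[symmetric, where P = P]) auto
  qed
  have ext_m': "extends_off I (neg_part \<nu>) m'"
    unfolding extends_off_def
  proof (intro conjI allI impI ballI zero sets_m)
    fix r :: real and B assume r: "r > 0" "B \<in> sets_off I r"
    have B: "B \<subseteq> space (R_space I)"
      using r off[of r] by (auto dest: sets.sets_into_space)
    then have *: "B \<inter> (space (R_space I) - P) = B - P" "B - (space (R_space I) - P) = B \<inter> P"
      by auto
    have "pos_part (\<lambda>E. measure m' E - measure m E) (sets_off I r) B = emeasure m' B"
      using r off[of r] null m_fin offP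
      by (intro pos_part_diff_measure[where P = "space (R_space I) - P"]) (auto simp: *)
    then show "emeasure m' B = neg_part \<nu> (sets_off I r) B"
      by (simp add: neg_part_def pos_part_def \<nu>_def)
  qed
  have ext_v: "extends_off I (total_variation \<nu>) v"
    unfolding extends_off_def \<nu>_def
  proof (intro conjI allI impI ballI zero sets_m)
    fix r :: real and B assume r: "r > 0" "B \<in> sets_off I r"
    then show "emeasure v B = total_variation (\<lambda>E. measure m E - measure m' E) (sets_off I r) B"
      using off null v_fin offP v_eq[OF subsetD[OF off]]
      by (intro total_variation_diff_measure[symmetric, where P = P]) auto
  qed
  have q_eq: "q_pos I \<nu> = m" "q_neg I \<nu> = m'" "q_var I \<nu> = v"
    unfolding q_pos_def q_neg_def q_var_def
    using ext_m ext_m' ext_v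
    by (auto intro!: the_equality elim: extends_off_unique[OF I])
  show thesis
  proof (rule that[of \<nu>])
    show "quasi_levy_type I \<nu>"
      unfolding quasi_levy_type_def q_eq
    proof (intro conjI allI impI)
      fix r :: real assume r: "r > 0"
      show "finite_signed_measure (sets_off I r) \<nu>"
        unfolding \<nu>_def
      proof (rule finite_signed_measure_diff_measure)
        fix E :: "nat \<Rightarrow> ('i \<Rightarrow> real) set" assume "range E \<subseteq> sets_off I r"
        then show "(\<Union>n. E n) \<in> sets_off I r"
          unfolding sets_off_def by blast
      qed (use off m_fin r in auto)
    next
      have "(\<integral>\<^sup>+x. ennreal (min 1 ((R_norm I x)\<^sup>2)) \<partial>v) = (\<integral>\<^sup>+x. ennreal \<bar>h x\<bar> * ennreal (?w x) \<partial>D)"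
        unfolding v_def levy_weight_def[symmetric] by (intro nn_integral_density) auto
      also have "\<dots> \<le> (\<integral>\<^sup>+x. 1 \<partial>D)"
        using hw by (intro nn_integral_mono) (simp flip: ennreal_mult)
      also have "\<dots> < \<infinity>" by (simp add: D.emeasure_finite less_top[symmetric])
      finally show "(\<integral>\<^sup>+x. ennreal (min 1 ((R_norm I x)\<^sup>2)) \<partial>v) < \<infinity>" .
    qed
    fix g :: "('i \<Rightarrow> real) \<Rightarrow> complex" and C
    assume g [measurable]: "g \<in> borel_measurable (R_space I)"
      and gw: "\<And>x. norm (g x) \<le> C * ?w x"
    have gw': "norm (g x) \<le> \<bar>C\<bar> * ?w x" for x
      by (rule order_trans[OF gw mult_right_mono]) auto
    have C: "\<bar>h x\<bar> * norm (g x) \<le> \<bar>C\<bar>" for x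
    proof -
      have "\<bar>h x\<bar> * norm (g x) \<le> \<bar>h x\<bar> * (\<bar>C\<bar> * ?w x)"
        using gw'[of x] by (intro mult_left_mono) auto
      also have "\<dots> = \<bar>C\<bar> * (\<bar>h x\<bar> * ?w x)" by simp
      also have "\<dots> \<le> \<bar>C\<bar> * 1" by (intro mult_left_mono hw) auto
      finally show ?thesis by simp
    qed
    have Cw: "norm (g x / of_real (?w x)) \<le> \<bar>C\<bar>" for x
      using gw'[of x] levy_weight_bounds(1)[of I x]
      by (cases "?w x = 0") (auto simp: norm_divide divide_le_eq less_le)
    have int: "integrable D (\<lambda>x. k x *\<^sub>R g x)"
      if [measurable]: "k \<in> borel_measurable (R_space I)" and "\<And>x. \<bar>k x\<bar> \<le> \<bar>h x\<bar>" for k :: "_ \<Rightarrow> real"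
      using order_trans[OF mult_right_mono[OF that(2)] C]
      by (intro D.integrable_const_bound[of _ "\<bar>C\<bar>"] AE_I2) auto
    have int': "integrable D (\<lambda>x. k x *\<^sub>R (g x / of_real (?w x)))"
      if [measurable]: "k \<in> borel_measurable (R_space I)" and "\<And>x. \<bar>k x\<bar> \<le> 1" for k :: "_ \<Rightarrow> real"
      using mult_mono[OF that(2) Cw]
      by (intro D.integrable_const_bound[of _ "\<bar>C\<bar>"] AE_I2) auto
    have dens: "(CLINT x|density D (\<lambda>x. ennreal (k x)). g x) = (CLINT x|D. max 0 (k x) *\<^sub>R g x)"
      if [measurable]: "k \<in> borel_measurable (R_space I)" for k
    proof -
      have "density D (\<lambda>x. ennreal (k x)) = density D (\<lambda>x. ennreal (max 0 (k x)))"
        by simp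
      then show ?thesis
        by (simp only:) (rule integral_density, measurable)
    qed
    have "q_integral I \<nu> g = (CLINT x|D. max 0 (h x) *\<^sub>R g x) - (CLINT x|D. max 0 (- h x) *\<^sub>R g x)"
      unfolding q_integral_def q_eq m_def m'_def by (simp add: dens)
    also have "\<dots> = (CLINT x|D. max 0 (h x) *\<^sub>R g x - max 0 (- h x) *\<^sub>R g x)"
      by (intro Bochner_Integration.integral_diff[symmetric] int) auto
    also have "\<dots> = (CLINT x|D. f x *\<^sub>R (g x / of_real (?w x)) - (1 - f x) *\<^sub>R (g x / of_real (?w x)))"
    proof (rule Bochner_Integration.integral_cong)
      fix x
      have "max 0 (h x) *\<^sub>R g x - max 0 (- h x) *\<^sub>R g x = h x *\<^sub>R g x"
        by (auto simp: max_def simp flip: scaleR_left_diff_distrib)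
      also have "\<dots> = f x *\<^sub>R (g x / of_real (?w x)) - (1 - f x) *\<^sub>R (g x / of_real (?w x))"
        by (simp add: h_def scaleR_conv_of_real algebra_simps diff_divide_distrib add_divide_distrib)
      finally show "max 0 (h x) *\<^sub>R g x - max 0 (- h x) *\<^sub>R g x
          = f x *\<^sub>R (g x / of_real (?w x)) - (1 - f x) *\<^sub>R (g x / of_real (?w x))" .
    qed simp
    also have "\<dots> = (CLINT x|D. f x *\<^sub>R (g x / of_real (?w x))) - (CLINT x|D. (1 - f x) *\<^sub>R (g x / of_real (?w x)))"
      using f01 by (intro Bochner_Integration.integral_diff int') auto
    also have "\<dots> = (CLINT x|G. g x / of_real (?w x)) - (CLINT x|G'. g x / of_real (?w x))"
      unfolding G_eq G'_eq using f01 by (simp add: integral_density)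
    finally show "q_integral I \<nu> g = (CLINT x|G. g x / of_real (?w x)) - (CLINT x|G'. g x / of_real (?w x))" .
  qed
qed

section \<open>Characteristic functions of convolution powers\<close>

lemma char_fn_iid_sum:
  assumes I: "finite I" and \<rho>: "distribution_on I \<rho>"
  shows "char_fn I (distr (PiM {..<n} (\<lambda>_. \<rho>)) (R_space I) (\<lambda>x. \<lambda>i\<in>I. \<Sum>k<n. x k i)) \<theta>
    = char_fn I \<rho> \<theta> ^ n"
proof -
  interpret \<rho>: prob_space \<rho> using \<rho> by (simp add: distribution_on_def)
  interpret P: product_prob_space "\<lambda>_. \<rho>" "{..<n}" ..
  have sets_\<rho> [measurable_cong]: "sets \<rho> = sets (R_space I)"
    using \<rho> by (simp add: distribution_on_def)
  have [measurable]: "(\<lambda>x. \<lambda>i\<in>I. \<Sum>k<n. x k i) \<in> measurable (PiM {..<n} (\<lambda>_. \<rho>)) (R_space I)"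
  proof (intro measurable_restrict borel_measurable_sum)
    fix i k assume "i \<in> I" "k \<in> {..<n}"
    then show "(\<lambda>x. x k i) \<in> borel_measurable (PiM {..<n} (\<lambda>_. \<rho>))"
      by (intro measurable_compose[OF measurable_component_singleton[of k]]) measurable
  qed
  have "char_fn I (distr (PiM {..<n} (\<lambda>_. \<rho>)) (R_space I) (\<lambda>x. \<lambda>i\<in>I. \<Sum>k<n. x k i)) \<theta>
      = (CLINT x|PiM {..<n} (\<lambda>_. \<rho>). iexp (R_inner I \<theta> (\<lambda>i\<in>I. \<Sum>k<n. x k i)))"
    unfolding char_fn_def by (rule integral_distr) measurable
  also have "\<dots> = (CLINT x|PiM {..<n} (\<lambda>_. \<rho>). (\<Prod>k<n. iexp (R_inner I \<theta> (x k))))"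
  proof (rule Bochner_Integration.integral_cong)
    fix x :: "nat \<Rightarrow> 'a \<Rightarrow> real"
    have "R_inner I \<theta> (\<lambda>i\<in>I. \<Sum>k<n. x k i) = (\<Sum>k<n. R_inner I \<theta> (x k))"
      unfolding R_inner_def by (simp add: sum_distrib_left) (rule sum.swap)
    then show "iexp (R_inner I \<theta> (\<lambda>i\<in>I. \<Sum>k<n. x k i)) = (\<Prod>k<n. iexp (R_inner I \<theta> (x k)))"
      by (simp add: exp_sum sum_distrib_left)
  qed simp
  also have "\<dots> = (\<Prod>k<n. CLINT x|\<rho>. iexp (R_inner I \<theta> x))"
    by (intro P.product_integral_prod) (auto intro!: \<rho>.integrable_const_bound[of _ 1])
  finally show ?thesis by (simp add: char_fn_def)
qed

lemma char_distr_R_inner: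
  assumes "distribution_on I \<rho>"
  shows "char (distr \<rho> borel (R_inner I \<theta>)) s = char_fn I \<rho> (\<lambda>i. s * \<theta> i)"
proof -
  have [measurable_cong]: "sets \<rho> = sets (R_space I)"
    using assms by (simp add: distribution_on_def)
  have "char (distr \<rho> borel (R_inner I \<theta>)) s = (CLINT x|\<rho>. iexp (s * R_inner I \<theta> x))"
    unfolding char_def by (rule integral_distr) measurable
  also have "\<dots> = char_fn I \<rho> (\<lambda>i. s * \<theta> i)"
    unfolding char_fn_def by (simp add: R_inner_def sum_distrib_left mult.assoc)
  finally show ?thesis .
qed

lemma real_distribution_R_inner:
  assumes "distribution_on I \<rho>"
  shows "real_distribution (distr \<rho> borel (R_inner I \<theta>))"
proof -
  interpret prob_space \<rho> using assms by (simp add: distribution_on_def)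
  have [measurable_cong]: "sets \<rho> = sets (R_space I)"
    using assms by (simp add: distribution_on_def)
  show ?thesis by (rule real_distribution_distr) measurable
qed

section \<open>The Levy-Khintchine formula\<close>

text \<open>
  Since \<open>n \<bar>1 - exp (g s / n)\<bar> \<le> \<bar>g s\<bar> exp \<bar>g s\<bar>\<close> for every \<open>n\<close> and \<open>g\<close> is continuous with \<open>g 0 = 0\<close>, the
  scaled differences \<open>n (1 - char (l n) s)\<close> are close to \<open>0\<close> on one interval \<open>[0, h]\<close> that serves all \<open>n\<close>.
\<close>

lemma char_roots_truncated_moment:
  fixes \<phi> :: "real \<Rightarrow> complex"
  assumes l: "\<And>n::nat. n \<ge> 1 \<Longrightarrow> real_distribution (l n)"
    and root: "\<And>n s. n \<ge> 1 \<Longrightarrow> char (l n) s ^ n = \<phi> s"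
    and \<epsilon>: "\<epsilon> > 0"
  shows "\<exists>h>0. \<forall>n\<ge>1. real n * (LINT x|l n. min 1 ((h * x)\<^sup>2)) \<le> \<epsilon>"
proof -
  obtain g where g: "continuous_on UNIV g" "g 0 = 0"
    "\<And>n s. n \<ge> 1 \<Longrightarrow> char (l n) s = exp (g s / of_nat n)"
    by (rule char_roots_eq_exp[OF l root]) auto
  let ?b = "\<lambda>s. exp (norm (g s)) * norm (g s)"
  have "continuous_on UNIV ?b" by (intro continuous_intros g)
  then have "isCont ?b 0" by (simp add: continuous_on_eq_continuous_at)
  then have "\<forall>e>0. \<exists>d>0. \<forall>s. \<bar>s\<bar> < d \<longrightarrow> ?b s < e"
    unfolding continuous_at_eps_delta by (simp add: dist_real_def g(2))
  from this[rule_format, of "\<epsilon> / 9"] \<epsilon>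
  obtain d where d: "d > 0" "\<And>s. \<bar>s\<bar> < d \<Longrightarrow> ?b s < \<epsilon> / 9" by auto
  show ?thesis
  proof (intro exI[of _ "d / 2"] conjI allI impI)
    fix n :: nat assume n: "n \<ge> 1"
    interpret real_distribution "l n" by (rule l[OF n])
    have "expectation (\<lambda>x. min 1 ((d / 2 * x)\<^sup>2)) \<le> 9 * (\<epsilon> / (9 * n))"
    proof (rule truncated_second_moment_le_char)
      fix s :: real assume s: "0 \<le> s" "s \<le> d / 2"
      have "1 - Re (char (l n) s) \<le> norm (1 - char (l n) s)"
        using complex_Re_le_cmod[of "1 - char (l n) s"] by simp
      then have "n * (1 - Re (char (l n) s)) \<le> n * norm (1 - char (l n) s)"
        by (intro mult_left_mono) auto
      also have "\<dots> \<le> ?b s"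
        using norm_scaled_exp_minus_one_le[OF n, of "g s"] by (simp add: g(3)[OF n] norm_minus_commute)
      also have "\<dots> \<le> \<epsilon> / 9" using d(2)[of s] d(1) s by (intro less_imp_le) auto
      finally show "1 - Re (char (l n) s) \<le> \<epsilon> / (9 * n)"
        using n by (simp add: field_simps)
    qed (use d in auto)
    then show "n * (LINT x|l n. min 1 ((d / 2 * x)\<^sup>2)) \<le> \<epsilon>"
      using n by (simp add: field_simps)
  qed (use d in auto)
qed

definition unit_vector :: "'i \<Rightarrow> 'i \<Rightarrow> real" where
  "unit_vector i = (\<lambda>j. of_bool (j = i))"

lemma R_inner_unit_vector: "finite I \<Longrightarrow> i \<in> I \<Longrightarrow> R_inner I (unit_vector i) x = x i"
  by (simp add: R_inner_def unit_vector_def)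

lemma trunc_inner_eq_sum:
  assumes "finite I"
  shows "trunc_inner I \<theta> x = (\<Sum>i\<in>I. \<theta> i * trunc_inner I (unit_vector i) x)"
proof -
  have "trunc_inner I (unit_vector i) x = x i / max 1 (R_norm I x)" if "i \<in> I" for i
    using assms that by (simp add: trunc_inner_def R_inner_unit_vector)
  then show ?thesis
    by (simp add: trunc_inner_def R_inner_def sum_divide_distrib)
qed

text \<open>
  The measure \<open>\<rho> n\<close> is an \<open>n\<close>-th convolution root of \<open>\<mu>\<close>, expressed by characteristic functions.
\<close>

locale convolution_roots =
  fixes I :: "'i set" and \<mu> :: "('i \<Rightarrow> real) measure" and \<rho> :: "nat \<Rightarrow> ('i \<Rightarrow> real) measure"
  assumes finite_I: "finite I"
    and root_distribution: "\<And>n. n \<ge> 1 \<Longrightarrow> distribution_on I (\<rho> n)"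
    and root: "\<And>n \<theta>. n \<ge> 1 \<Longrightarrow> char_fn I (\<rho> n) \<theta> ^ n = char_fn I \<mu> \<theta>"
begin

lemma prob_space_root: "n \<ge> 1 \<Longrightarrow> prob_space (\<rho> n)"
  using root_distribution by (simp add: distribution_on_def)

lemma sets_root: "n \<ge> 1 \<Longrightarrow> sets (\<rho> n) = sets (R_space I)"
  using root_distribution by (simp add: distribution_on_def)

lemma integrable_root:
  fixes F :: "('i \<Rightarrow> real) \<Rightarrow> 'b::{banach, second_countable_topology}"
  assumes "n \<ge> 1" "F \<in> borel_measurable (R_space I)" "\<And>x. norm (F x) \<le> C"
  shows "integrable (\<rho> n) F"
proof -
  interpret prob_space "\<rho> n" by (rule prob_space_root[OF assms(1)])
  show ?thesis
    using assms(2,3) by (intro integrable_const_bound[of _ C])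
      (auto simp: measurable_cong_sets[OF sets_root[OF assms(1)] refl])
qed

text \<open>
  The logarithm is taken along the line through \<open>\<theta>\<close>, where the problem is one-dimensional.
\<close>

lemma exponent:
  obtains \<Psi> where "char_fn I \<mu> \<theta> = exp \<Psi>"
    "(\<lambda>n. of_nat n * (char_fn I (\<rho> n) \<theta> - 1)) \<longlonglongrightarrow> \<Psi>"
proof -
  let ?l = "\<lambda>n. distr (\<rho> n) borel (R_inner I \<theta>)"
  have ch: "char (?l n) s = char_fn I (\<rho> n) (\<lambda>i. s * \<theta> i)" if "n \<ge> 1" for n s
    by (rule char_distr_R_inner[OF root_distribution[OF that]])
  have rd: "real_distribution (?l n)" if "n \<ge> 1" for n
    by (rule real_distribution_R_inner[OF root_distribution[OF that]])
  obtain g where g: "\<And>n s. n \<ge> 1 \<Longrightarrow> char (?l n) s = exp (g s / of_nat n)"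
    by (rule char_roots_eq_exp[of ?l "\<lambda>s. char_fn I \<mu> (\<lambda>i. s * \<theta> i)"])
       (auto simp: rd ch root)
  have \<phi>: "char_fn I (\<rho> n) \<theta> = exp (g 1 / of_nat n)" if "n \<ge> 1" for n
    using g[OF that, of 1] ch[OF that, of 1] by simp
  show thesis
  proof (rule that[of "g 1"])
    show "char_fn I \<mu> \<theta> = exp (g 1)"
      using root[of 1 \<theta>] \<phi>[of 1] by simp
    show "(\<lambda>n. of_nat n * (char_fn I (\<rho> n) \<theta> - 1)) \<longlonglongrightarrow> g 1"
    proof (rule Lim_transform_eventually[OF scaled_exp_minus_one_tendsto])
      show "\<forall>\<^sub>F n in sequentially. of_nat n * (exp (g 1 / of_nat n) - 1)
          = of_nat n * (char_fn I (\<rho> n) \<theta> - 1)"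
        using eventually_ge_at_top[of 1] by eventually_elim (simp add: \<phi>)
    qed
  qed
qed

lemma coordinate_truncated_moment:
  assumes i: "i \<in> I" and \<epsilon>: "\<epsilon> > 0"
  shows "\<exists>h>0. \<forall>n\<ge>1. real n * (LINT x|\<rho> n. min 1 ((h * x i)\<^sup>2)) \<le> \<epsilon>"
proof -
  let ?e = "unit_vector i"
  let ?l = "\<lambda>n. distr (\<rho> n) borel (R_inner I ?e)"
  have rd: "real_distribution (?l n)" if "n \<ge> 1" for n
    by (rule real_distribution_R_inner[OF root_distribution[OF that]])
  have "\<exists>h>0. \<forall>n\<ge>1. real n * (LINT x|?l n. min 1 ((h * x)\<^sup>2)) \<le> \<epsilon>"
    by (rule char_roots_truncated_moment[of ?l "\<lambda>s. char_fn I \<mu> (\<lambda>i. s * ?e i)"])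
       (auto simp: rd char_distr_R_inner[OF root_distribution] root \<epsilon>)
  moreover have "(LINT x|?l n. min 1 ((h * x)\<^sup>2)) = (LINT x|\<rho> n. min 1 ((h * x i)\<^sup>2))"
    if "n \<ge> 1" for n h
  proof -
    have [measurable_cong]: "sets (\<rho> n) = sets (R_space I)" by (rule sets_root[OF that])
    have "(LINT x|?l n. min 1 ((h * x)\<^sup>2)) = (LINT x|\<rho> n. min 1 ((h * R_inner I ?e x)\<^sup>2))"
      by (rule integral_distr) measurable
    then show ?thesis using i finite_I by (simp add: R_inner_unit_vector)
  qed
  ultimately show ?thesis by (metis (no_types, lifting))
qed

lemma integrable_coordinate:
  assumes "n \<ge> 1" "i \<in> I"
  shows "integrable (\<rho> n) (\<lambda>x. min 1 ((h * x i)\<^sup>2))"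
  using assms by (intro integrable_root[of _ _ 1]) auto

text \<open>
  The weight is at most the sum over the coordinates of \<open>min 1 ((x i)\<^sup>2)\<close>, and each of these is at
  most a constant multiple of \<open>min 1 ((h * x i)\<^sup>2)\<close>, whose scaled moments are bounded.
\<close>

lemma scaled_weight_bounded:
  obtains C where "C > 0" "\<And>n. n \<ge> 1 \<Longrightarrow> real n * (LINT x|\<rho> n. levy_weight I x) \<le> C"
proof -
  (* The factor 1 keeps the integrand an instance, h = 1, of the scaled truncated squares. *)
  have "\<exists>c. \<forall>n\<ge>1. real n * (LINT x|\<rho> n. min 1 ((1 * x i)\<^sup>2)) \<le> c" if i: "i \<in> I" for i
  proof -
    obtain h where h: "h > 0" "\<And>n. n \<ge> 1 \<Longrightarrow> real n * (LINT x|\<rho> n. min 1 ((h * x i)\<^sup>2)) \<le> 1"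
      using coordinate_truncated_moment[OF i, of 1] by auto
    define c where "c = max 1 (1 / h\<^sup>2)"
    have c: "1 \<le> c" "1 \<le> c * h\<^sup>2"
      using h(1) by (auto simp: c_def max_def field_simps)
    have le: "min 1 ((1 * x i)\<^sup>2) \<le> c * min 1 ((h * x i)\<^sup>2)" for x :: "'i \<Rightarrow> real"
    proof (cases "(h * x i)\<^sup>2 \<le> 1")
      case True
      have "1 * (x i)\<^sup>2 \<le> (c * h\<^sup>2) * (x i)\<^sup>2" by (intro mult_right_mono c) auto
      then show ?thesis using True by (simp add: power_mult_distrib min_def)
    next
      case False
      then show ?thesis using c by simp
    qed
    have "real n * (LINT x|\<rho> n. min 1 ((1 * x i)\<^sup>2)) \<le> c" if n: "n \<ge> 1" for n
    proof -
      have "(LINT x|\<rho> n. min 1 ((1 * x i)\<^sup>2)) \<le> (LINT x|\<rho> n. c * min 1 ((h * x i)\<^sup>2))"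
        by (intro integral_mono le integrable_mult_right integrable_coordinate[OF n i])
      then have "real n * (LINT x|\<rho> n. min 1 ((1 * x i)\<^sup>2))
          \<le> c * (real n * (LINT x|\<rho> n. min 1 ((h * x i)\<^sup>2)))"
        using mult_left_mono[of _ _ "real n"] by (fastforce simp: mult_ac)
      also have "\<dots> \<le> c * 1" using h(2)[OF n] c by (intro mult_left_mono) auto
      finally show ?thesis by simp
    qed
    then show ?thesis by blast
  qed
  then obtain c where c: "\<And>i n. i \<in> I \<Longrightarrow> n \<ge> 1 \<Longrightarrow> real n * (LINT x|\<rho> n. min 1 ((1 * x i)\<^sup>2)) \<le> c i"
    by metis
  have w: "levy_weight I x \<le> (\<Sum>i\<in>I. min 1 ((1 * x i)\<^sup>2))" for x
  proof (cases "\<exists>i\<in>I. 1 < (x i)\<^sup>2")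
    case True
    then obtain i where i: "i \<in> I" "1 < (x i)\<^sup>2" by blast
    have "min 1 ((1 * x i)\<^sup>2) \<le> (\<Sum>i\<in>I. min 1 ((1 * x i)\<^sup>2))"
      using finite_I i by (intro member_le_sum) auto
    then show ?thesis using i by (auto intro: order_trans[OF levy_weight_bounds(2)])
  next
    case False
    then have "(\<Sum>i\<in>I. min 1 ((1 * x i)\<^sup>2)) = (\<Sum>i\<in>I. (x i)\<^sup>2)"
      by (intro sum.cong) (auto simp: not_less min_def)
    then show ?thesis by (simp add: levy_weight_def L2_set_def sum_nonneg)
  qed
  show thesis
  proof (rule that[of "max 1 (\<Sum>i\<in>I. c i)"])
    fix n :: nat assume n: "n \<ge> 1"
    have "real n * (LINT x|\<rho> n. levy_weight I x) \<le> real n * (LINT x|\<rho> n. (\<Sum>i\<in>I. min 1 ((1 * x i)\<^sup>2)))"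
      by (intro mult_left_mono integral_mono w Bochner_Integration.integrable_sum
          integrable_coordinate[OF n] integrable_root[OF n, of _ 1]) auto
    also have "\<dots> = (\<Sum>i\<in>I. real n * (LINT x|\<rho> n. min 1 ((1 * x i)\<^sup>2)))"
      by (subst Bochner_Integration.integral_sum) (auto intro: integrable_coordinate[OF n, of _ 1, simplified] simp: sum_distrib_left)
    also have "\<dots> \<le> (\<Sum>i\<in>I. c i)" by (intro sum_mono c n)
    finally show "real n * (LINT x|\<rho> n. levy_weight I x) \<le> max 1 (\<Sum>i\<in>I. c i)" by simp
  qed simp
qed

text \<open>
  If the \<open>\<ell>\<^sup>1\<close>-norm exceeds \<open>R = (\<Sum>i\<in>I. 1 / h i)\<close>, some coordinate has \<open>\<bar>h i * x i\<bar> \<ge> 1\<close>, so the tail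
  event is dominated by the sum of the truncated squares.
\<close>

lemma scaled_tail_bounded:
  assumes \<epsilon>: "\<epsilon> > 0"
  obtains R where "0 \<le> R"
    "\<And>n. n \<ge> 1 \<Longrightarrow> real n * measure (\<rho> n) {x \<in> space (R_space I). R < (\<Sum>i\<in>I. \<bar>x i\<bar>)} \<le> \<epsilon>"
proof -
  define \<delta> where "\<delta> = \<epsilon> / (card I + 1)"
  have \<delta>: "\<delta> > 0" using \<epsilon> by (simp add: \<delta>_def)
  obtain h where h: "\<And>i. i \<in> I \<Longrightarrow> h i > 0"
    "\<And>i n. i \<in> I \<Longrightarrow> n \<ge> 1 \<Longrightarrow> real n * (LINT x|\<rho> n. min 1 ((h i * x i)\<^sup>2)) \<le> \<delta>"
    using coordinate_truncated_moment[OF _ \<delta>] by metis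
  define R where "R = (\<Sum>i\<in>I. 1 / h i)"
  show thesis
  proof (rule that[of R])
    show "0 \<le> R" unfolding R_def by (intro sum_nonneg) (auto simp: h less_imp_le)
    fix n :: nat assume n: "n \<ge> 1"
    interpret prob_space "\<rho> n" by (rule prob_space_root[OF n])
    have [measurable_cong]: "sets (\<rho> n) = sets (R_space I)" by (rule sets_root[OF n])
    let ?T = "{x \<in> space (R_space I). R < (\<Sum>i\<in>I. \<bar>x i\<bar>)}"
    have T: "?T \<in> sets (\<rho> n)" by measurable
    have le: "indicator ?T x \<le> (\<Sum>i\<in>I. min 1 ((h i * x i)\<^sup>2))" for x
    proof (cases "x \<in> ?T")
      case True
      have "\<exists>i\<in>I. 1 / h i < \<bar>x i\<bar>"
      proof (rule ccontr)
        assume "\<not> ?thesis"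
        then have "(\<Sum>i\<in>I. \<bar>x i\<bar>) \<le> R" unfolding R_def by (intro sum_mono) (auto simp: not_less)
        then show False using True by simp
      qed
      then obtain i where i: "i \<in> I" "1 / h i < \<bar>x i\<bar>" by blast
      then have "1 \<le> \<bar>h i * x i\<bar>" using h(1)[OF i(1)] by (simp add: field_simps abs_mult)
      then have "1\<^sup>2 \<le> \<bar>h i * x i\<bar>\<^sup>2" by (intro power_mono) auto
      then have "min 1 ((h i * x i)\<^sup>2) = 1" by simp
      moreover have "min 1 ((h i * x i)\<^sup>2) \<le> (\<Sum>i\<in>I. min 1 ((h i * x i)\<^sup>2))"
        using finite_I i by (intro member_le_sum) auto
      ultimately show ?thesis using True by simp
    qed (simp add: sum_nonneg)
    have "measure (\<rho> n) ?T = (LINT x|\<rho> n. indicator ?T x)" using T by simp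
    also have "\<dots> \<le> (LINT x|\<rho> n. (\<Sum>i\<in>I. min 1 ((h i * x i)\<^sup>2)))"
      using T by (intro integral_mono le Bochner_Integration.integrable_sum integrable_coordinate[OF n])
        (auto simp: emeasure_eq_measure)
    also have "\<dots> = (\<Sum>i\<in>I. (LINT x|\<rho> n. min 1 ((h i * x i)\<^sup>2)))"
      by (intro Bochner_Integration.integral_sum integrable_coordinate[OF n])
    finally have "real n * measure (\<rho> n) ?T \<le> (\<Sum>i\<in>I. real n * (LINT x|\<rho> n. min 1 ((h i * x i)\<^sup>2)))"
      unfolding sum_distrib_left[symmetric] by (intro mult_left_mono) auto
    also have "\<dots> \<le> (\<Sum>i\<in>I. \<delta>)" by (intro sum_mono h n)
    also have "\<dots> \<le> \<epsilon>" using \<epsilon> by (simp add: \<delta>_def field_simps)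
    finally show "real n * measure (\<rho> n) ?T \<le> \<epsilon>" .
  qed
qed

text \<open>
  \<open>P k\<close> is \<open>1 / C\<close> times the measure with density \<open>Suc k * levy_weight\<close> with respect to \<open>\<rho> (Suc k)\<close>,
  completed to a probability measure by an atom at the origin. The atom affects neither tails nor
  integrals of functions vanishing at the origin, and it keeps \<open>P\<close> tight even if the masses tend to \<open>0\<close>.
\<close>

lemma normalized_measures:
  obtains C P where "C > 0" "\<And>k. distribution_on I (P k)"
    "\<And>\<epsilon>. \<epsilon> > 0 \<Longrightarrow> \<exists>R. \<forall>k. measure (P k) {x \<in> space (R_space I). R < (\<Sum>i\<in>I. \<bar>x i\<bar>)} < \<epsilon>"
    "\<And>(F :: ('i \<Rightarrow> real) \<Rightarrow> complex) B k. F \<in> borel_measurable (R_space I) \<Longrightarrow>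
       (\<And>x. norm (F x) \<le> B) \<Longrightarrow> F (R_zero I) = 0 \<Longrightarrow>
       of_real C * (CLINT x|P k. F x) = of_nat (Suc k) * (CLINT x|\<rho> (Suc k). of_real (levy_weight I x) * F x)"
proof -
  obtain C where C: "C > 0" "\<And>n. n \<ge> 1 \<Longrightarrow> real n * (LINT x|\<rho> n. levy_weight I x) \<le> C"
    by (rule scaled_weight_bounded) blast
  define m where "m k = real (Suc k) * (LINT x|\<rho> (Suc k). levy_weight I x) / C" for k
  have m: "0 \<le> m k" "m k \<le> 1" for k
    using C(1) C(2)[of "Suc k"] by (auto simp: m_def intro!: divide_nonneg_nonneg mult_nonneg_nonneg)
  have zero: "R_zero I \<in> space (R_space I)" by (simp add: R_zero_def space_PiM)
  define G where "G k = density (\<rho> (Suc k)) (\<lambda>x. ennreal (real (Suc k) * levy_weight I x / C))" for k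
  define N where "N k = density (return (R_space I) (R_zero I)) (\<lambda>_. ennreal (1 - m k))" for k
  have [measurable_cong, simp]: "sets (\<rho> (Suc k)) = sets (R_space I)" for k by (simp add: sets_root)
  have [simp]: "sets (G k) = sets (R_space I)" "sets (N k) = sets (R_space I)" for k
    by (simp_all add: G_def N_def)
  have int_w: "integrable (\<rho> (Suc k)) (\<lambda>x. real (Suc k) * levy_weight I x / C)" for k
    by (intro integrable_divide integrable_mult_right integrable_root[of _ _ 1]) auto
  have emG: "emeasure (G k) (space (R_space I)) = ennreal (m k)" for k
  proof -
    have "space (\<rho> (Suc k)) = space (R_space I)" by (rule sets_eq_imp_space_eq) simp
    then have "emeasure (G k) (space (R_space I)) = (\<integral>\<^sup>+x. ennreal (real (Suc k) * levy_weight I x / C) \<partial>\<rho> (Suc k))"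
      unfolding G_def by (subst emeasure_density) (auto intro!: nn_integral_cong)
    also have "\<dots> = ennreal (m k)"
      using C(1) by (subst nn_integral_eq_integral[OF int_w]) (auto simp: m_def)
    finally show ?thesis .
  qed
  have emN: "emeasure (N k) A = ennreal (1 - m k) * indicator A (R_zero I)" if "A \<in> sets (R_space I)" for k A
    unfolding N_def using that zero by (subst emeasure_density) (auto simp: nn_integral_return)
  have finG: "finite_measure (G k)" for k
    using emG[of k] by (intro finite_measureI) (simp add: sets_eq_imp_space_eq[of "G k" "R_space I"])
  have finN: "finite_measure (N k)" for k
    using emN[of "space (R_space I)" k]
    by (intro finite_measureI) (simp add: sets_eq_imp_space_eq[of "N k" "R_space I"] ennreal_mult_eq_top_iff zero)
  have "\<exists>D. finite_measure D \<and> sets D = sets (R_space I) \<and> (\<forall>A. emeasure D A = emeasure (G k) A + emeasure (N k) A)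
      \<and> (\<forall>(F :: ('i \<Rightarrow> real) \<Rightarrow> complex) B. F \<in> borel_measurable (R_space I) \<longrightarrow> (\<forall>x. norm (F x) \<le> B) \<longrightarrow>
            integral\<^sup>L D F = integral\<^sup>L (G k) F + integral\<^sup>L (N k) F)" for k
  proof (rule finite_measure_sum[OF finG[of k] finN[of k]])
    show "sets (N k) = sets (G k)" by simp
    fix D assume "finite_measure D" "sets D = sets (G k)"
      "\<And>A. emeasure D A = emeasure (G k) A + emeasure (N k) A"
      and F: "\<And>(F :: ('i \<Rightarrow> real) \<Rightarrow> complex) B. F \<in> borel_measurable (G k) \<Longrightarrow> (\<And>x. norm (F x) \<le> B) \<Longrightarrow>
         integral\<^sup>L D F = integral\<^sup>L (G k) F + integral\<^sup>L (N k) F"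
    moreover have "integral\<^sup>L D F = integral\<^sup>L (G k) F + integral\<^sup>L (N k) F"
      if "F \<in> borel_measurable (R_space I)" "\<forall>x. norm (F x) \<le> B" for F :: "('i \<Rightarrow> real) \<Rightarrow> complex" and B
      using that by (intro F[of F B]) (auto simp: measurable_cong_sets[of "G k" "R_space I"])
    ultimately show ?thesis by (intro exI[of _ D]) auto
  qed
  then obtain P where P: "\<And>k. finite_measure (P k)" "\<And>k. sets (P k) = sets (R_space I)"
    "\<And>k A. emeasure (P k) A = emeasure (G k) A + emeasure (N k) A"
    "\<And>k (F :: ('i \<Rightarrow> real) \<Rightarrow> complex) B. F \<in> borel_measurable (R_space I) \<Longrightarrow> (\<And>x. norm (F x) \<le> B) \<Longrightarrow>
       integral\<^sup>L (P k) F = integral\<^sup>L (G k) F + integral\<^sup>L (N k) F"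
    by metis
  show thesis
  proof (rule that[OF C(1), of P])
    fix k
    have "emeasure (P k) (space (P k)) = 1"
      using m[of k] emN[of "space (R_space I)" k] zero
      by (simp add: sets_eq_imp_space_eq[OF P(2)] P(3) emG flip: ennreal_plus)
    then show "distribution_on I (P k)"
      unfolding distribution_on_def using P(2) by (auto intro: prob_spaceI)
  next
    fix \<epsilon> :: real assume \<epsilon>: "\<epsilon> > 0"
    obtain R where R: "0 \<le> R" "\<And>n. n \<ge> 1 \<Longrightarrow>
        real n * measure (\<rho> n) {x \<in> space (R_space I). R < (\<Sum>i\<in>I. \<bar>x i\<bar>)} \<le> \<epsilon> * C / 2"
      using scaled_tail_bounded[of "\<epsilon> * C / 2"] \<epsilon> C(1) by auto
    show "\<exists>R. \<forall>k. measure (P k) {x \<in> space (R_space I). R < (\<Sum>i\<in>I. \<bar>x i\<bar>)} < \<epsilon>"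
    proof (intro exI[of _ R] allI)
      fix k
      let ?T = "{x \<in> space (R_space I). R < (\<Sum>i\<in>I. \<bar>x i\<bar>)}"
      interpret \<rho>: prob_space "\<rho> (Suc k)" by (rule prob_space_root) simp
      have T: "?T \<in> sets (R_space I)" by measurable
      have "R_zero I \<notin> ?T" using R(1) by (simp add: R_zero_def)
      then have "emeasure (P k) ?T = emeasure (G k) ?T" by (simp add: P(3) emN[OF T])
      also have "\<dots> = (\<integral>\<^sup>+x. ennreal (real (Suc k) * levy_weight I x / C) * indicator ?T x \<partial>\<rho> (Suc k))"
        unfolding G_def using T by (subst emeasure_density) auto
      also have "\<dots> \<le> (\<integral>\<^sup>+x. ennreal (real (Suc k) / C) * indicator ?T x \<partial>\<rho> (Suc k))"
        using C(1)
        by (intro nn_integral_mono mult_right_mono ennreal_leI divide_right_mono) (auto intro: mult_left_le)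
      also have "\<dots> = ennreal (real (Suc k) / C * measure (\<rho> (Suc k)) ?T)"
        using T C(1)
        by (subst nn_integral_cmult_indicator) (auto simp: \<rho>.emeasure_eq_measure ennreal_mult'[symmetric])
      also have "\<dots> \<le> ennreal (\<epsilon> / 2)"
        using R(2)[of "Suc k"] C(1) by (intro ennreal_leI) (simp add: field_simps)
      finally have "measure (P k) ?T \<le> \<epsilon> / 2"
        using \<epsilon> unfolding measure_def by (intro enn2real_leI) auto
      then show "measure (P k) ?T < \<epsilon>" using \<epsilon> by simp
    qed
  next
    fix F :: "('i \<Rightarrow> real) \<Rightarrow> complex" and B k
    assume F [measurable]: "F \<in> borel_measurable (R_space I)" and B: "\<And>x. norm (F x) \<le> B"
      and F0: "F (R_zero I) = 0"
    have "integral\<^sup>L (N k) F = 0"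
      unfolding N_def using m[of k] zero
      by (subst integral_density) (auto simp: integral_return F0)
    moreover have "integral\<^sup>L (G k) F = (CLINT x|\<rho> (Suc k). (real (Suc k) * levy_weight I x / C) *\<^sub>R F x)"
      unfolding G_def using C(1) by (intro integral_density) auto
    ultimately have "of_real C * (CLINT x|P k. F x)
        = of_real C * (CLINT x|\<rho> (Suc k). (of_nat (Suc k) / of_real C) * (of_real (levy_weight I x) * F x))"
      using P(4)[OF F B, of k] by (simp add: scaleR_conv_of_real mult_ac)
    also have "\<dots> = of_nat (Suc k) * (CLINT x|\<rho> (Suc k). of_real (levy_weight I x) * F x)"
      using C(1) by simp
    finally show "of_real C * (CLINT x|P k. F x)
        = of_nat (Suc k) * (CLINT x|\<rho> (Suc k). of_real (levy_weight I x) * F x)" .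
  qed
qed

lemma integrable_trunc_inner: "n \<ge> 1 \<Longrightarrow> integrable (\<rho> n) (trunc_inner I \<theta>)"
  by (rule integrable_root[of _ _ "R_norm I \<theta>"]) (auto intro: abs_trunc_inner_le)

lemma integrable_trunc_inner_mult:
  assumes "n \<ge> 1"
  shows "integrable (\<rho> n) (\<lambda>x. trunc_inner I \<theta> x * trunc_inner I \<eta> x)"
proof (rule integrable_root[OF assms])
  fix x
  show "norm (trunc_inner I \<theta> x * trunc_inner I \<eta> x) \<le> R_norm I \<theta> * R_norm I \<eta>"
    using abs_trunc_inner_mult_le[of I \<theta> x \<eta>]
      mult_left_mono[OF levy_weight_bounds(2)[of I x], of "R_norm I \<theta> * R_norm I \<eta>"] by simp
qed measurable

text \<open>
  Where the weight vanishes, the estimates of the kernel and of the truncation force both sides to vanish.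
\<close>

lemma iexp_decomposition:
  "iexp (R_inner I \<theta> x) - 1 = \<i> * of_real (trunc_inner I \<theta> x)
     - of_real (trunc_inner I \<theta> x * trunc_inner I \<theta> x) / 2
     + of_real (levy_weight I x) * levy_remainder I \<theta> x"
proof -
  have "levy_kernel I \<theta> x + of_real ((trunc_inner I \<theta> x)\<^sup>2 / 2)
      = of_real (levy_weight I x) * levy_remainder I \<theta> x"
  proof (cases "levy_weight I x = 0")
    case True
    then have "levy_kernel I \<theta> x = 0" "trunc_inner I \<theta> x = 0"
      using norm_levy_kernel_le[of I \<theta> x] abs_trunc_inner_mult_le[of I \<theta> x \<theta>]
      by (auto simp: mult_le_0_iff)
    then show ?thesis using True by simp
  qed (simp add: levy_remainder_def)
  then show ?thesis
    unfolding levy_kernel_def R_inner_trunc by (simp add: power2_eq_square algebra_simps)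
qed

lemma levy_remainder_zero [simp]: "levy_remainder I \<theta> (R_zero I) = 0"
  by (simp add: levy_remainder_def levy_weight_def L2_set_def R_zero_def)

text \<open>
  Along the subsequence \<open>r\<close> both \<open>n (\<phi>\<^sub>n - 1)\<close> and the integrals of the remainder converge, hence so does
  \<open>i d - q / 2\<close>, with \<open>d\<close> linear and \<open>q\<close> quadratic in \<open>\<theta>\<close>. Its limit \<open>Z\<close> therefore has the form of
  the drift and Gaussian terms. The quadratic term in the remainder, integrated against the limit
  measure, is the correction \<open>D\<close> of the covariance matrix.
\<close>

lemma levy_khintchine:
  obtains \<gamma> A G where "\<gamma> \<in> space (R_space I)" "\<And>i j. A i j = A j i"
    "finite_measure G" "sets G = sets (R_space I)"
    "\<And>\<theta>. char_fn I \<mu> \<theta> = exp (\<i> * of_real (R_inner I \<theta> \<gamma>)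
        - of_real (R_inner I \<theta> (\<lambda>i\<in>I. \<Sum>j\<in>I. A i j * \<theta> j)) / 2
        + (CLINT x|G. levy_kernel I \<theta> x / of_real (levy_weight I x)))"
proof -
  let ?t = "trunc_inner I" and ?w = "levy_weight I" and ?e = unit_vector
  obtain C P where C: "C > 0" and P: "\<And>k. distribution_on I (P k)"
    and tight: "\<And>\<epsilon>. \<epsilon> > 0 \<Longrightarrow> \<exists>R. \<forall>k. measure (P k) {x \<in> space (R_space I). R < (\<Sum>i\<in>I. \<bar>x i\<bar>)} < \<epsilon>"
    and P_int: "\<And>(F :: ('i \<Rightarrow> real) \<Rightarrow> complex) B k. F \<in> borel_measurable (R_space I) \<Longrightarrow>
       (\<And>x. norm (F x) \<le> B) \<Longrightarrow> F (R_zero I) = 0 \<Longrightarrow>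
       of_real C * (CLINT x|P k. F x) = of_nat (Suc k) * (CLINT x|\<rho> (Suc k). of_real (?w x) * F x)"
    by (rule normalized_measures) blast
  obtain r L where r: "strict_mono r" and L: "distribution_on I L"
    and lim: "\<And>(F :: ('i \<Rightarrow> real) \<Rightarrow> complex) B. continuous_on UNIV F \<Longrightarrow> F \<in> borel_measurable (R_space I)
       \<Longrightarrow> (\<And>x. norm (F x) \<le> B) \<Longrightarrow> (\<lambda>n. integral\<^sup>L (P (r n)) F) \<longlonglongrightarrow> integral\<^sup>L L F"
  proof (rule tight_R_space_imp_convergent_subsequence[OF finite_I P tight])
    fix r L
    assume "strict_mono r" "distribution_on I L"
      "\<And>(F :: ('i \<Rightarrow> real) \<Rightarrow> complex) B. continuous_on UNIV F \<Longrightarrow> F \<in> borel_measurable (R_space I)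
       \<Longrightarrow> (\<And>x. norm (F x) \<le> B) \<Longrightarrow> (\<lambda>n. integral\<^sup>L (P (r n)) F) \<longlonglongrightarrow> integral\<^sup>L L F"
    then show thesis by (rule that)
  qed
  interpret L: prob_space L using L by (simp add: distribution_on_def)
  have sets_L [measurable_cong]: "sets L = sets (R_space I)" using L by (simp add: distribution_on_def)
  define d where "d k \<theta> = real (Suc k) * (LINT x|\<rho> (Suc k). ?t \<theta> x)" for k \<theta>
  define q where "q k \<theta> \<eta> = real (Suc k) * (LINT x|\<rho> (Suc k). ?t \<theta> x * ?t \<eta> x)" for k \<theta> \<eta>
  have d_sum: "d k \<theta> = (\<Sum>i\<in>I. \<theta> i * d k (?e i))" for k \<theta>
  proof -
    have "(LINT x|\<rho> (Suc k). ?t \<theta> x) = (LINT x|\<rho> (Suc k). (\<Sum>i\<in>I. \<theta> i * ?t (?e i) x))"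
      by (simp only: trunc_inner_eq_sum[OF finite_I, of \<theta>])
    also have "\<dots> = (\<Sum>i\<in>I. \<theta> i * (LINT x|\<rho> (Suc k). ?t (?e i) x))"
      by (simp add: Bochner_Integration.integral_sum integrable_trunc_inner)
    finally show ?thesis
      by (simp only: d_def sum_distrib_left mult.left_commute)
  qed
  have q_sum: "q k \<theta> \<theta> = (\<Sum>i\<in>I. \<Sum>j\<in>I. \<theta> i * \<theta> j * q k (?e i) (?e j))" for k \<theta>
  proof -
    have "(LINT x|\<rho> (Suc k). ?t \<theta> x * ?t \<theta> x)
        = (LINT x|\<rho> (Suc k). (\<Sum>i\<in>I. \<Sum>j\<in>I. \<theta> i * \<theta> j * (?t (?e i) x * ?t (?e j) x)))"
      by (simp only: trunc_inner_eq_sum[OF finite_I, of \<theta>] sum_product mult_ac)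
    also have "\<dots> = (\<Sum>i\<in>I. \<Sum>j\<in>I. \<theta> i * \<theta> j * (LINT x|\<rho> (Suc k). ?t (?e i) x * ?t (?e j) x))"
      by (simp add: Bochner_Integration.integral_sum integrable_trunc_inner_mult)
    finally show ?thesis
      by (simp only: q_def sum_distrib_left mult.left_commute)
  qed
  define K where "K \<theta> = of_real C * (CLINT x|L. levy_remainder I \<theta> x)" for \<theta>
  have "\<exists>\<Psi>. \<forall>\<theta>. char_fn I \<mu> \<theta> = exp (\<Psi> \<theta>)
      \<and> (\<lambda>n. of_nat n * (char_fn I (\<rho> n) \<theta> - 1)) \<longlonglongrightarrow> \<Psi> \<theta>"
    by (rule choice, rule allI, rule exponent) blast
  then obtain \<Psi> where \<Psi>: "\<And>\<theta>. char_fn I \<mu> \<theta> = exp (\<Psi> \<theta>)"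
    "\<And>\<theta>. (\<lambda>n. of_nat n * (char_fn I (\<rho> n) \<theta> - 1)) \<longlonglongrightarrow> \<Psi> \<theta>" by blast
  have decomp: "of_nat (Suc k) * (char_fn I (\<rho> (Suc k)) \<theta> - 1)
      = \<i> * of_real (d k \<theta>) - of_real (q k \<theta> \<theta>) / 2 + of_real C * (CLINT x|P k. levy_remainder I \<theta> x)"
    for k \<theta>
  proof -
    interpret \<rho>: prob_space "\<rho> (Suc k)" by (rule prob_space_root) simp
    have n: "Suc k \<ge> 1" by simp
    have int_iexp: "complex_integrable (\<rho> (Suc k)) (\<lambda>x. iexp (R_inner I \<theta> x))"
      by (rule integrable_root[OF n, of _ 1]) auto
    have int_rem: "complex_integrable (\<rho> (Suc k)) (\<lambda>x. of_real (?w x) * levy_remainder I \<theta> x)"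
    proof (rule integrable_root[OF n])
      fix x
      show "norm (of_real (?w x) * levy_remainder I \<theta> x) \<le> 1 * (2 + R_norm I \<theta> + 2 * (R_norm I \<theta>)\<^sup>2)"
        unfolding norm_mult by (intro mult_mono norm_levy_remainder_le) auto
    qed measurable
    have int1: "complex_integrable (\<rho> (Suc k)) (\<lambda>x. \<i> * of_real (?t \<theta> x))"
      "complex_integrable (\<rho> (Suc k)) (\<lambda>x. of_real (?t \<theta> x * ?t \<theta> x) / 2)"
      using integrable_trunc_inner[OF n, of \<theta>] integrable_trunc_inner_mult[OF n, of \<theta> \<theta>]
      by (simp_all del: of_real_mult)
    have "char_fn I (\<rho> (Suc k)) \<theta> - 1 = (CLINT x|\<rho> (Suc k). iexp (R_inner I \<theta> x) - 1)"
      unfolding char_fn_def using int_iexp by (simp add: \<rho>.prob_space)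
    also have "\<dots> = (CLINT x|\<rho> (Suc k). \<i> * of_real (?t \<theta> x) - of_real (?t \<theta> x * ?t \<theta> x) / 2
        + of_real (?w x) * levy_remainder I \<theta> x)"
      by (simp only: iexp_decomposition)
    also have "\<dots> = (CLINT x|\<rho> (Suc k). \<i> * of_real (?t \<theta> x)) - (CLINT x|\<rho> (Suc k). of_real (?t \<theta> x * ?t \<theta> x) / 2)
        + (CLINT x|\<rho> (Suc k). of_real (?w x) * levy_remainder I \<theta> x)"
      using int1 int_rem by simp
    also have "\<dots> = \<i> * of_real (LINT x|\<rho> (Suc k). ?t \<theta> x) - of_real (LINT x|\<rho> (Suc k). ?t \<theta> x * ?t \<theta> x) / 2
        + (CLINT x|\<rho> (Suc k). of_real (?w x) * levy_remainder I \<theta> x)"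
      by (simp del: of_real_mult)
    finally have "of_nat (Suc k) * (char_fn I (\<rho> (Suc k)) \<theta> - 1)
        = of_nat (Suc k) * (\<i> * of_real (LINT x|\<rho> (Suc k). ?t \<theta> x)
            - of_real (LINT x|\<rho> (Suc k). ?t \<theta> x * ?t \<theta> x) / 2
            + (CLINT x|\<rho> (Suc k). of_real (?w x) * levy_remainder I \<theta> x))"
      by (rule arg_cong)
    also have "\<dots> = \<i> * of_real (d k \<theta>) - of_real (q k \<theta> \<theta>) / 2
          + of_nat (Suc k) * (CLINT x|\<rho> (Suc k). of_real (?w x) * levy_remainder I \<theta> x)"
      by (simp add: d_def q_def algebra_simps del: of_nat_Suc)
    finally have "of_nat (Suc k) * (char_fn I (\<rho> (Suc k)) \<theta> - 1)
        = \<i> * of_real (d k \<theta>) - of_real (q k \<theta> \<theta>) / 2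
          + of_nat (Suc k) * (CLINT x|\<rho> (Suc k). of_real (?w x) * levy_remainder I \<theta> x)" .
    then show ?thesis
      by (subst P_int[OF borel_measurable_levy_remainder norm_levy_remainder_le levy_remainder_zero])
  qed
  define Z where "Z \<theta> = \<Psi> \<theta> - K \<theta>" for \<theta>
  have Z: "(\<lambda>k. \<i> * of_real (d (r k) \<theta>) - of_real (q (r k) \<theta> \<theta>) / 2) \<longlonglongrightarrow> Z \<theta>" for \<theta>
  proof -
    have "(\<lambda>k. of_nat (Suc k) * (char_fn I (\<rho> (Suc k)) \<theta> - 1)) \<longlonglongrightarrow> \<Psi> \<theta>"
      using \<Psi>(2)[of \<theta>] by (rule LIMSEQ_Suc)
    then have "(\<lambda>k. of_nat (Suc (r k)) * (char_fn I (\<rho> (Suc (r k))) \<theta> - 1)) \<longlonglongrightarrow> \<Psi> \<theta>"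
      using LIMSEQ_subseq_LIMSEQ[OF _ r] by (fastforce simp: o_def)
    moreover have "(\<lambda>k. of_real C * (CLINT x|P (r k). levy_remainder I \<theta> x)) \<longlonglongrightarrow> K \<theta>"
      unfolding K_def
      by (intro tendsto_mult_left lim[OF continuous_on_levy_remainder borel_measurable_levy_remainder
            norm_levy_remainder_le])
    ultimately have "(\<lambda>k. of_nat (Suc (r k)) * (char_fn I (\<rho> (Suc (r k))) \<theta> - 1)
        - of_real C * (CLINT x|P (r k). levy_remainder I \<theta> x)) \<longlonglongrightarrow> Z \<theta>"
      unfolding Z_def by (rule tendsto_diff)
    then show ?thesis by (simp only: decomp add_diff_cancel_right')
  qed
  have d_lim: "(\<lambda>k. d (r k) \<theta>) \<longlonglongrightarrow> Im (Z \<theta>)" for \<theta>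
    using tendsto_Im[OF Z[of \<theta>]] by simp
  have q_lim: "(\<lambda>k. q (r k) \<theta> \<theta>) \<longlonglongrightarrow> - 2 * Re (Z \<theta>)" for \<theta>
    using tendsto_mult_left[OF tendsto_Re[OF Z[of \<theta>]], of "- 2"] by simp
  define \<gamma> where "\<gamma> = (\<lambda>i\<in>I. Im (Z (?e i)))"
  have Im_Z: "Im (Z \<theta>) = R_inner I \<theta> \<gamma>" for \<theta>
  proof (rule LIMSEQ_unique[OF d_lim])
    show "(\<lambda>k. d (r k) \<theta>) \<longlonglongrightarrow> R_inner I \<theta> \<gamma>"
      unfolding R_inner_def \<gamma>_def
      by (subst d_sum) (auto intro!: tendsto_sum tendsto_mult_left d_lim)
  qed
  (* Polarization recovers the matrix of the limiting quadratic form - 2 * Re (Z \<theta>). *)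
  define B where "B i j = - Re (Z (\<lambda>l. ?e i l + ?e j l)) + Re (Z (?e i)) + Re (Z (?e j))" for i j
  have polar: "q k (\<lambda>l. \<theta> l + \<eta> l) (\<lambda>l. \<theta> l + \<eta> l) = q k \<theta> \<theta> + 2 * q k \<theta> \<eta> + q k \<eta> \<eta>" for k \<theta> \<eta>
  proof -
    have t_add: "?t (\<lambda>l. \<theta> l + \<eta> l) x = ?t \<theta> x + ?t \<eta> x" for x
      by (simp add: trunc_inner_def R_inner_def distrib_right sum.distrib add_divide_distrib)
    have "(LINT x|\<rho> (Suc k). ?t (\<lambda>l. \<theta> l + \<eta> l) x * ?t (\<lambda>l. \<theta> l + \<eta> l) x)
        = (LINT x|\<rho> (Suc k). ?t \<theta> x * ?t \<theta> x + 2 * (?t \<theta> x * ?t \<eta> x) + ?t \<eta> x * ?t \<eta> x)"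
      unfolding t_add
      by (intro Bochner_Integration.integral_cong) (simp_all add: algebra_simps)
    also have "\<dots> = (LINT x|\<rho> (Suc k). ?t \<theta> x * ?t \<theta> x) + 2 * (LINT x|\<rho> (Suc k). ?t \<theta> x * ?t \<eta> x)
        + (LINT x|\<rho> (Suc k). ?t \<eta> x * ?t \<eta> x)"
      by (simp add: integrable_trunc_inner_mult)
    finally show ?thesis by (simp add: q_def algebra_simps)
  qed
  have B_lim: "(\<lambda>k. q (r k) (?e i) (?e j)) \<longlonglongrightarrow> B i j" for i j
  proof -
    have "(\<lambda>k. (q (r k) (\<lambda>l. ?e i l + ?e j l) (\<lambda>l. ?e i l + ?e j l) - q (r k) (?e i) (?e i)
        - q (r k) (?e j) (?e j)) / 2)
        \<longlonglongrightarrow> (- 2 * Re (Z (\<lambda>l. ?e i l + ?e j l)) - - 2 * Re (Z (?e i)) - - 2 * Re (Z (?e j))) / 2"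
      by (intro tendsto_intros q_lim) simp
    then show ?thesis by (simp add: polar B_def add_divide_distrib diff_divide_distrib)
  qed
  have Re_Z: "- 2 * Re (Z \<theta>) = (\<Sum>i\<in>I. \<Sum>j\<in>I. \<theta> i * \<theta> j * B i j)" for \<theta>
  proof (rule LIMSEQ_unique[OF q_lim])
    show "(\<lambda>k. q (r k) \<theta> \<theta>) \<longlonglongrightarrow> (\<Sum>i\<in>I. \<Sum>j\<in>I. \<theta> i * \<theta> j * B i j)"
      by (subst q_sum) (intro tendsto_sum tendsto_mult_left B_lim)
  qed
  define D where "D i j = C * (LINT x|L. ?t (?e i) x * ?t (?e j) x / ?w x)" for i j
  (* D is the truncated second moment matrix of the Levy measure. *)
  define A where "A i j = B i j - D i j" for i j
  have intD: "integrable L (\<lambda>x. ?t \<theta> x * ?t \<eta> x / ?w x)" for \<theta> \<eta>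
  proof (rule L.integrable_const_bound[of _ "R_norm I \<theta> * R_norm I \<eta>"])
    show "AE x in L. norm (?t \<theta> x * ?t \<eta> x / ?w x) \<le> R_norm I \<theta> * R_norm I \<eta>"
    proof (rule AE_I2)
      fix x
      show "norm (?t \<theta> x * ?t \<eta> x / ?w x) \<le> R_norm I \<theta> * R_norm I \<eta>"
        using abs_trunc_inner_mult_le[of I \<theta> x \<eta>] levy_weight_bounds(1)[of I x]
        by (cases "?w x = 0") (auto simp: abs_divide divide_le_eq less_le)
    qed
  qed measurable
  have intK: "complex_integrable L (\<lambda>x. levy_kernel I \<theta> x / of_real (?w x))" for \<theta>
    by (rule L.integrable_const_bound[of _ "2 + R_norm I \<theta> + (R_norm I \<theta>)\<^sup>2"])
       (auto intro!: AE_I2 norm_divide_levy_weight_le norm_levy_kernel_le)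
  have D_sum: "C * (LINT x|L. ?t \<theta> x * ?t \<theta> x / ?w x) = (\<Sum>i\<in>I. \<Sum>j\<in>I. \<theta> i * \<theta> j * D i j)" for \<theta>
  proof -
    have "(LINT x|L. ?t \<theta> x * ?t \<theta> x / ?w x)
        = (LINT x|L. (\<Sum>i\<in>I. \<Sum>j\<in>I. \<theta> i * \<theta> j * (?t (?e i) x * ?t (?e j) x / ?w x)))"
      by (simp only: trunc_inner_eq_sum[OF finite_I, of \<theta>] sum_product sum_divide_distrib times_divide_eq_right mult_ac)
    also have "\<dots> = (\<Sum>i\<in>I. \<Sum>j\<in>I. \<theta> i * \<theta> j * (LINT x|L. ?t (?e i) x * ?t (?e j) x / ?w x))"
      by (simp only: Bochner_Integration.integral_sum integrable_mult_right intD
          Bochner_Integration.integrable_sum Bochner_Integration.integral_mult_right_zero)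
    finally show ?thesis
      by (simp only: D_def sum_distrib_left mult.left_commute)
  qed
  define G where "G = density L (\<lambda>_. ennreal C)"
  have sets_G: "sets G = sets (R_space I)" unfolding G_def by (simp add: sets_L)
  have fin_G: "finite_measure G"
    unfolding G_def
    by (intro finite_measureI) (simp add: emeasure_density ennreal_mult_eq_top_iff)
  have K_eq: "K \<theta> = (CLINT x|G. levy_kernel I \<theta> x / of_real (?w x))
      + of_real (\<Sum>i\<in>I. \<Sum>j\<in>I. \<theta> i * \<theta> j * D i j) / 2" for \<theta>
  proof -
    have "(CLINT x|L. levy_remainder I \<theta> x)
        = (CLINT x|L. levy_kernel I \<theta> x / of_real (?w x) + of_real (?t \<theta> x * ?t \<theta> x / ?w x) / 2)"
      unfolding levy_remainder_def
      by (intro Bochner_Integration.integral_cong) (auto simp: add_divide_distrib power2_eq_square)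
    also have "\<dots> = (CLINT x|L. levy_kernel I \<theta> x / of_real (?w x))
        + (CLINT x|L. of_real (?t \<theta> x * ?t \<theta> x / ?w x) / 2)"
      by (intro Bochner_Integration.integral_add intK integrable_divide integrable_of_real intD)
    also have "(CLINT x|L. of_real (?t \<theta> x * ?t \<theta> x / ?w x) / 2)
        = complex_of_real (LINT x|L. ?t \<theta> x * ?t \<theta> x / ?w x) / 2"
      by (simp only: integral_divide_zero integral_complex_of_real)
    finally have "K \<theta> = of_real C * (CLINT x|L. levy_kernel I \<theta> x / of_real (?w x))
        + of_real (C * (LINT x|L. ?t \<theta> x * ?t \<theta> x / ?w x)) / 2"
      by (simp add: K_def distrib_left)
    moreover have "(CLINT x|G. levy_kernel I \<theta> x / of_real (?w x))
        = of_real C * (CLINT x|L. levy_kernel I \<theta> x / of_real (?w x))"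
    proof -
      have "(CLINT x|G. levy_kernel I \<theta> x / of_real (?w x))
          = (CLINT x|L. C *\<^sub>R (levy_kernel I \<theta> x / of_real (?w x)))"
        unfolding G_def using C by (intro integral_density) auto
      then show ?thesis
        by (simp only: integral_scaleR_right) (simp only: scaleR_conv_of_real)
    qed
    ultimately show ?thesis by (simp only: D_sum)
  qed
  have A_sum: "R_inner I \<theta> (\<lambda>i\<in>I. \<Sum>j\<in>I. A i j * \<theta> j)
      = (\<Sum>i\<in>I. \<Sum>j\<in>I. \<theta> i * \<theta> j * B i j) - (\<Sum>i\<in>I. \<Sum>j\<in>I. \<theta> i * \<theta> j * D i j)" for \<theta>
    unfolding R_inner_def A_def sum_subtractf[symmetric]
    by (intro sum.cong) (auto simp: sum_distrib_left algebra_simps sum_subtractf intro!: sum.cong)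
  show thesis
  proof (rule that[of \<gamma> A G])
    show "\<gamma> \<in> space (R_space I)" by (simp add: \<gamma>_def space_PiM)
    show "A i j = A j i" for i j
    proof -
      have "(\<lambda>l. ?e i l + ?e j l) = (\<lambda>l. ?e j l + ?e i l)" by (simp add: add.commute)
      then show ?thesis by (simp add: A_def B_def D_def mult.commute)
    qed
    show "finite_measure G" "sets G = sets (R_space I)" by (fact fin_G sets_G)+
    fix \<theta>
    have "\<Psi> \<theta> = Z \<theta> + K \<theta>" by (simp add: Z_def)
    also have "Z \<theta> = \<i> * of_real (R_inner I \<theta> \<gamma>) - of_real (\<Sum>i\<in>I. \<Sum>j\<in>I. \<theta> i * \<theta> j * B i j) / 2"
      unfolding Re_Z[symmetric] Im_Z[symmetric] by (simp add: complex_eq_iff)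
    finally have "\<Psi> \<theta> = \<i> * of_real (R_inner I \<theta> \<gamma>)
        - of_real (R_inner I \<theta> (\<lambda>i\<in>I. \<Sum>j\<in>I. A i j * \<theta> j)) / 2
        + (CLINT x|G. levy_kernel I \<theta> x / of_real (?w x))"
      unfolding A_sum K_eq of_real_diff by (simp add: diff_divide_distrib)
    then show "char_fn I \<mu> \<theta> = exp (\<i> * of_real (R_inner I \<theta> \<gamma>)
        - of_real (R_inner I \<theta> (\<lambda>i\<in>I. \<Sum>j\<in>I. A i j * \<theta> j)) / 2
        + (CLINT x|G. levy_kernel I \<theta> x / of_real (?w x)))"
      by (simp add: \<Psi>(1))
  qed
qed

end

lemma inf_divisible_levy_khintchine:
  assumes I: "finite I" and \<mu>: "inf_divisible I \<mu>"
  obtains \<gamma> A G where "\<gamma> \<in> space (R_space I)" "\<And>i j. A i j = A j i"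
    "finite_measure G" "sets G = sets (R_space I)"
    "\<And>\<theta>. char_fn I \<mu> \<theta> = exp (\<i> * of_real (R_inner I \<theta> \<gamma>)
        - of_real (R_inner I \<theta> (\<lambda>i\<in>I. \<Sum>j\<in>I. A i j * \<theta> j)) / 2
        + (CLINT x|G. levy_kernel I \<theta> x / of_real (levy_weight I x)))"
proof -
  have "\<exists>\<rho>. \<forall>n::nat\<ge>1. distribution_on I (\<rho> n) \<and>
      \<mu> = distr (PiM {..<n} (\<lambda>_. \<rho> n)) (R_space I) (\<lambda>x. \<lambda>i\<in>I. \<Sum>k<n. x k i)"
    using \<mu> unfolding inf_divisible_def by metis
  then obtain \<rho> where \<rho>: "\<And>n::nat. n \<ge> 1 \<Longrightarrow> distribution_on I (\<rho> n)"
    "\<And>n. n \<ge> 1 \<Longrightarrow> \<mu> = distr (PiM {..<n} (\<lambda>_. \<rho> n)) (R_space I) (\<lambda>x. \<lambda>i\<in>I. \<Sum>k<n. x k i)"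
    by blast
  interpret convolution_roots I \<mu> \<rho>
  proof
    fix n :: nat and \<theta> assume n: "n \<ge> 1"
    show "char_fn I (\<rho> n) \<theta> ^ n = char_fn I \<mu> \<theta>"
      by (subst \<rho>(2)[OF n]) (rule char_fn_iid_sum[OF I \<rho>(1)[OF n], symmetric])
  qed (fact I \<rho>(1))+
  show thesis by (rule levy_khintchine) (rule that)
qed

text \<open>
  Subtract the drifts, the matrices and the Levy measures of the two infinitely divisible laws.
\<close>

lemma quasi_inf_divisible_of_quotient:
  assumes I: "finite I" and \<mu>: "distribution_on I \<mu>"
    and y: "inf_divisible I \<mu>y" and z: "inf_divisible I \<mu>z"
    and eq: "\<And>\<theta>. char_fn I \<mu>z \<theta> = char_fn I \<mu> \<theta> * char_fn I \<mu>y \<theta>"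
  shows "quasi_inf_divisible I \<mu>"
proof -
  let ?w = "levy_weight I"
  obtain \<gamma>z Az Gz where z': "\<gamma>z \<in> space (R_space I)" "\<And>i j. Az i j = Az j i"
    "finite_measure Gz" "sets Gz = sets (R_space I)"
    "\<And>\<theta>. char_fn I \<mu>z \<theta> = exp (\<i> * of_real (R_inner I \<theta> \<gamma>z)
        - of_real (R_inner I \<theta> (\<lambda>i\<in>I. \<Sum>j\<in>I. Az i j * \<theta> j)) / 2
        + (CLINT x|Gz. levy_kernel I \<theta> x / of_real (?w x)))"
    by (rule inf_divisible_levy_khintchine[OF I z]) blast
  obtain \<gamma>y Ay Gy where y': "\<gamma>y \<in> space (R_space I)" "\<And>i j. Ay i j = Ay j i"
    "finite_measure Gy" "sets Gy = sets (R_space I)"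
    "\<And>\<theta>. char_fn I \<mu>y \<theta> = exp (\<i> * of_real (R_inner I \<theta> \<gamma>y)
        - of_real (R_inner I \<theta> (\<lambda>i\<in>I. \<Sum>j\<in>I. Ay i j * \<theta> j)) / 2
        + (CLINT x|Gy. levy_kernel I \<theta> x / of_real (?w x)))"
    by (rule inf_divisible_levy_khintchine[OF I y]) blast
  obtain \<nu> where \<nu>: "quasi_levy_type I \<nu>"
    "\<And>g C. g \<in> borel_measurable (R_space I) \<Longrightarrow> (\<And>x. norm (g x) \<le> C * ?w x) \<Longrightarrow>
       q_integral I \<nu> g = (CLINT x|Gz. g x / of_real (?w x)) - (CLINT x|Gy. g x / of_real (?w x))"
    by (rule quasi_levy_type_difference[OF I z'(3,4) y'(3,4)]) blast
  define \<gamma> where "\<gamma> = (\<lambda>i\<in>I. \<gamma>z i - \<gamma>y i)"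
  define A where "A i j = Az i j - Ay i j" for i j
  have *: "char_fn I \<mu> \<theta> = exp (\<i> * of_real (R_inner I \<theta> \<gamma>)
      - of_real (R_inner I \<theta> (\<lambda>i\<in>I. \<Sum>j\<in>I. A i j * \<theta> j)) / 2 + q_integral I \<nu> (levy_kernel I \<theta>))" for \<theta>
  proof -
    have g: "R_inner I \<theta> \<gamma> = R_inner I \<theta> \<gamma>z - R_inner I \<theta> \<gamma>y"
      by (simp add: R_inner_def \<gamma>_def right_diff_distrib sum_subtractf)
    have a: "R_inner I \<theta> (\<lambda>i\<in>I. \<Sum>j\<in>I. A i j * \<theta> j)
        = R_inner I \<theta> (\<lambda>i\<in>I. \<Sum>j\<in>I. Az i j * \<theta> j) - R_inner I \<theta> (\<lambda>i\<in>I. \<Sum>j\<in>I. Ay i j * \<theta> j)"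
      by (simp add: R_inner_def A_def left_diff_distrib right_diff_distrib sum_subtractf)
    have n: "q_integral I \<nu> (levy_kernel I \<theta>) = (CLINT x|Gz. levy_kernel I \<theta> x / of_real (?w x))
        - (CLINT x|Gy. levy_kernel I \<theta> x / of_real (?w x))"
      by (rule \<nu>(2)[OF borel_measurable_levy_kernel norm_levy_kernel_le])
    have "char_fn I \<mu> \<theta> = char_fn I \<mu>z \<theta> / char_fn I \<mu>y \<theta>"
      unfolding eq by (simp add: y'(5))
    then show ?thesis
      unfolding z'(5) y'(5) g a n exp_diff[symmetric]
      by (simp add: algebra_simps diff_divide_distrib)
  qed
  show ?thesis
    unfolding quasi_inf_divisible_def
  proof (intro conjI exI ballI)
    show "distribution_on I \<mu>" by fact
    show "\<gamma> \<in> space (R_space I)" by (simp add: \<gamma>_def space_PiM)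
    show "A i j = A j i" for i j using z'(2)[of i j] y'(2)[of i j] by (simp add: A_def)
    show "quasi_levy_type I \<nu>" by (rule \<nu>(1))
  qed (use * in \<open>simp add: levy_kernel_def[abs_def]\<close>)
qed

section \<open>Processes\<close>

lemma measurable_process_restrict:
  "process M T X \<Longrightarrow> J \<subseteq> T \<Longrightarrow> (\<lambda>\<omega>. \<lambda>t\<in>J. X t \<omega>) \<in> measurable M (R_space J)"
  by (intro measurable_restrict) (auto simp: process_def)

lemma distribution_on_fdd: "process M T X \<Longrightarrow> J \<subseteq> T \<Longrightarrow> distribution_on J (fdd M X J)"
  unfolding distribution_on_def fdd_def
  by (auto intro!: prob_space.prob_space_distr measurable_process_restrict simp: process_def)

lemma char_fn_fdd:
  assumes "process M T X" "J \<subseteq> T"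
  shows "char_fn J (fdd M X J) \<theta> = (CLINT \<omega>|M. iexp (\<Sum>t\<in>J. \<theta> t * X t \<omega>))"
proof -
  have "char_fn J (fdd M X J) \<theta> = (CLINT \<omega>|M. iexp (R_inner J \<theta> (\<lambda>t\<in>J. X t \<omega>)))"
    unfolding char_fn_def fdd_def
    by (rule integral_distr[OF measurable_process_restrict[OF assms]]) measurable
  then show ?thesis by (simp add: R_inner_def)
qed

text \<open>
  Independence of the whole processes passes to the two exponentials, which are functions of the
  coordinates in \<open>J \<subseteq> T\<close>.
\<close>

lemma char_fn_fdd_add:
  assumes X: "process M T X" and Y: "process M T Y" and indep: "indep_processes M T X Y"
    and J: "finite J" "J \<subseteq> T"
  shows "char_fn J (fdd M (\<lambda>t \<omega>. X t \<omega> + Y t \<omega>) J) \<theta> = char_fn J (fdd M X J) \<theta> * char_fn J (fdd M Y J) \<theta>"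
proof -
  interpret prob_space M using X by (simp add: process_def)
  have XY: "process M T (\<lambda>t \<omega>. X t \<omega> + Y t \<omega>)" using X Y by (auto simp: process_def intro!: borel_measurable_add)
  let ?f = "\<lambda>x :: 'b \<Rightarrow> real. iexp (\<Sum>t\<in>J. \<theta> t * x t)"
  have f: "?f \<in> borel_measurable (R_space T)"
  proof -
    have "(\<lambda>x :: 'b \<Rightarrow> real. x t) \<in> borel_measurable (R_space T)" if "t \<in> J" for t
      using that J by (intro measurable_component_singleton) auto
    then show ?thesis by measurable
  qed
  have "indep_var borel (?f \<circ> (\<lambda>\<omega>. \<lambda>t\<in>T. X t \<omega>)) borel (?f \<circ> (\<lambda>\<omega>. \<lambda>t\<in>T. Y t \<omega>))"
    using indep unfolding indep_processes_def by (rule indep_var_compose[OF _ f f])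
  moreover have "?f \<circ> (\<lambda>\<omega>. \<lambda>t\<in>T. X t \<omega>) = (\<lambda>\<omega>. iexp (\<Sum>t\<in>J. \<theta> t * X t \<omega>))" for X :: "'b \<Rightarrow> 'a \<Rightarrow> real"
  proof -
    have "(\<Sum>t\<in>J. \<theta> t * (\<lambda>t\<in>T. X t \<omega>) t) = (\<Sum>t\<in>J. \<theta> t * X t \<omega>)" for \<omega>
      using J by (intro sum.cong) auto
    then show ?thesis by (simp add: fun_eq_iff del: of_real_sum)
  qed
  ultimately have ind: "indep_var borel (\<lambda>\<omega>. iexp (\<Sum>t\<in>J. \<theta> t * X t \<omega>)) borel (\<lambda>\<omega>. iexp (\<Sum>t\<in>J. \<theta> t * Y t \<omega>))"
    by simp
  have int: "complex_integrable M (\<lambda>\<omega>. iexp (\<Sum>t\<in>J. \<theta> t * X t \<omega>))" if "process M T X" for X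
  proof (rule integrable_const_bound[of _ 1])
    have "X t \<in> borel_measurable M" if "t \<in> J" for t
      using \<open>process M T X\<close> that J by (auto simp: process_def)
    then show "(\<lambda>\<omega>. iexp (\<Sum>t\<in>J. \<theta> t * X t \<omega>)) \<in> borel_measurable M" by measurable
  qed auto
  have "iexp (\<Sum>t\<in>J. \<theta> t * (X t \<omega> + Y t \<omega>)) = iexp (\<Sum>t\<in>J. \<theta> t * X t \<omega>) * iexp (\<Sum>t\<in>J. \<theta> t * Y t \<omega>)" for \<omega>
    by (simp add: sum.distrib distrib_left exp_add)
  then show ?thesis
    unfolding char_fn_fdd[OF X J(2)] char_fn_fdd[OF Y J(2)] char_fn_fdd[OF XY J(2)]
    using indep_var_lebesgue_integral[OF ind int[OF X] int[OF Y]] by simp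
qed

theorem theorem7p3:
  fixes T :: "'t set"
    and M :: "'a measure" and X :: "'t \<Rightarrow> 'a \<Rightarrow> real"
  assumes "process M T X"
    and "\<exists>(Y :: 't \<Rightarrow> 'a \<Rightarrow> real) (N :: 'b measure) (Z :: 't \<Rightarrow> 'b \<Rightarrow> real).
           ID_process M T Y \<and> ID_process N T Z \<and>
           indep_processes M T X Y \<and>
           fdd_equal T M (\<lambda>t \<omega>. X t \<omega> + Y t \<omega>) N Z"
  shows "QID_process M T X"
proof -
  obtain Y :: "'t \<Rightarrow> 'a \<Rightarrow> real" and N :: "'b measure" and Z :: "'t \<Rightarrow> 'b \<Rightarrow> real"
    where Y: "ID_process M T Y" and Z: "ID_process N T Z" and indep: "indep_processes M T X Y"
      and eq: "fdd_equal T M (\<lambda>t \<omega>. X t \<omega> + Y t \<omega>) N Z"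
    using assms(2) by blast
  show ?thesis
    unfolding QID_process_def
  proof (intro conjI allI impI)
    show "process M T X" by fact
    fix J assume "finite J \<and> J \<subseteq> T"
    then have J: "finite J" "J \<subseteq> T" by auto
    show "quasi_inf_divisible J (fdd M X J)"
    proof (rule quasi_inf_divisible_of_quotient[OF J(1)])
      show "distribution_on J (fdd M X J)" by (rule distribution_on_fdd[OF assms(1) J(2)])
      show "inf_divisible J (fdd M Y J)" "inf_divisible J (fdd N Z J)"
        using Y Z J by (auto simp: ID_process_def)
      have "process M T Y" using Y by (simp add: ID_process_def)
      moreover have "fdd N Z J = fdd M (\<lambda>t \<omega>. X t \<omega> + Y t \<omega>) J"
        using eq J by (simp add: fdd_equal_def)
      ultimately show "char_fn J (fdd N Z J) \<theta> = char_fn J (fdd M X J) \<theta> * char_fn J (fdd M Y J) \<theta>" for \<theta>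
        using char_fn_fdd_add[OF assms(1) _ indep J] by simp
    qed
  qed
qed

end
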